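(* Let $\mu,\nu\in\mathbb{R}$ and let $f\in C_b^1([0,\infty))$ with $\lim_{x\to\infty}f(x)=0$. Then there exists a unique function $u$ satisfying $u\in C^\infty((0,\infty)\times[0,\infty))$, $u,u_x\in C_b([0,T]\times[0,\infty))$ for every $T>0$, $\lim_{x\to\infty}u(t,x)=0$ for every $t>0$, and solving the initial boundary value problem \[ u_t=\mu u_x+\tfrac12 u_{xx}\ \ (t>0,\ x\ge 0),\qquad u(0,x)=f(x)\ \ (x\ge 0),\qquad u_t(t,0)=\nu u_x(t,0)\ \ (t>0). \]
   Context: $C_b^1([0,\infty))$ denotes the set of $C^1$ functions $f$ on $[0,\infty)$ such that $f$ and $f'$ are bounded on $[0,\infty)$. $C_b(A)$ denotes bounded continuous functions on $A$. No sign restriction is imposed on $\nu$ (in particular $\nu<0$ is allowed). *)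

theory Defs
  imports "HOL-Analysis.Analysis"
begin

text \<open>Functions of two real variables are curried: u t x.
  Iterated partial derivatives on a set S (a subset of the plane); derivatives are taken
  within the slices of S (so one-sided at boundary points).\<close>

inductive is_pderiv :: "(real \<times> real) set \<Rightarrow> (real \<Rightarrow> real \<Rightarrow> real) \<Rightarrow> (real \<Rightarrow> real \<Rightarrow> real) \<Rightarrow> bool"
  for S :: "(real \<times> real) set" and u :: "real \<Rightarrow> real \<Rightarrow> real" where
  base: "is_pderiv S u u"
| dt: "is_pderiv S u g \<Longrightarrow>
     (\<forall>t x. (t, x) \<in> S \<longrightarrow> ((\<lambda>s. g s x) has_real_derivative h t x) (at t within {s. (s, x) \<in> S}))
     \<Longrightarrow> is_pderiv S u h"
| dx: "is_pderiv S u g \<Longrightarrow>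
     (\<forall>t x. (t, x) \<in> S \<longrightarrow> ((\<lambda>y. g t y) has_real_derivative h t x) (at x within {y. (t, y) \<in> S}))
     \<Longrightarrow> is_pderiv S u h"

definition smooth2_on :: "(real \<times> real) set \<Rightarrow> (real \<Rightarrow> real \<Rightarrow> real) \<Rightarrow> bool" where
  "smooth2_on S u \<longleftrightarrow>
     (\<forall>g. is_pderiv S u g \<longrightarrow>
        continuous_on S (\<lambda>(t, x). g t x)
      \<and> (\<exists>h. \<forall>t x. (t, x) \<in> S \<longrightarrow> ((\<lambda>s. g s x) has_real_derivative h t x) (at t within {s. (s, x) \<in> S}))
      \<and> (\<exists>h. \<forall>t x. (t, x) \<in> S \<longrightarrow> ((\<lambda>y. g t y) has_real_derivative h t x) (at x within {y. (t, y) \<in> S})))"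

definition Cb1_halfline :: "(real \<Rightarrow> real) \<Rightarrow> bool" where
  "Cb1_halfline f \<longleftrightarrow>
     (\<exists>f'. (\<forall>x\<ge>0. (f has_real_derivative f' x) (at x within {0..}))
         \<and> continuous_on {0..} f'
         \<and> bounded (f ` {0..}) \<and> bounded (f' ` {0..}))"

definition Cb2_on :: "(real \<times> real) set \<Rightarrow> (real \<Rightarrow> real \<Rightarrow> real) \<Rightarrow> bool" where
  "Cb2_on A g \<longleftrightarrow> continuous_on A (\<lambda>(t, x). g t x) \<and> bounded ((\<lambda>(t, x). g t x) ` A)"

definition is_solution :: "real \<Rightarrow> real \<Rightarrow> (real \<Rightarrow> real) \<Rightarrow> (real \<Rightarrow> real \<Rightarrow> real) \<Rightarrow> bool" where
  "is_solution \<mu> \<nu> f u \<longleftrightarrow>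
     smooth2_on ({0<..} \<times> {0..}) u
   \<and> (\<exists>ux.
        (\<forall>t\<ge>0. \<forall>x\<ge>0. ((\<lambda>y. u t y) has_real_derivative ux t x) (at x within {0..}))
      \<and> (\<forall>T>0. Cb2_on ({0..T} \<times> {0..}) u \<and> Cb2_on ({0..T} \<times> {0..}) ux)
      \<and> (\<forall>t>0. \<forall>x\<ge>0. \<exists>uxx. ((\<lambda>y. ux t y) has_real_derivative uxx) (at x within {0..})
                          \<and> ((\<lambda>s. u s x) has_real_derivative (\<mu> * ux t x + uxx / 2)) (at t))
      \<and> (\<forall>t>0. ((\<lambda>s. u s 0) has_real_derivative (\<nu> * ux t 0)) (at t)))
   \<and> (\<forall>t>0. ((\<lambda>x. u t x) \<longlongrightarrow> 0) at_top)
   \<and> (\<forall>x\<ge>0. u 0 x = f x)"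

end

theory Submission
  imports Defs "HOL-Probability.Distributions"
begin

text \<open>
  Existence. Extend \<open>f\<close> to a function \<open>F\<close> on the whole line and let
  \<open>u t x\<close> be the expectation of \<open>F (x + \<mu> t + B t)\<close> for a Brownian motion \<open>B\<close>; this solves
  the equation, and \<open>u\<^sub>x\<close> is the same expectation for \<open>G = F'\<close>. By the equation the boundary
  condition reads \<open>u\<^sub>x\<^sub>x + a u\<^sub>x = 0\<close> at \<open>x = 0\<close> with \<open>a = 2 (\<mu> - \<nu>)\<close>. It holds if the
  (generalised) function \<open>g = G' + a G\<close> has the symmetry \<open>g (- y) = - exp (2 \<mu> y) g y\<close>, which is
  reflection for the heat operator with drift. This is a linear ODE for \<open>G\<close> on the negative half line;
  substituting \<open>G (- y) = exp (2 \<mu> y) f' y + K y\<close> removes \<open>f''\<close> from it and leaves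
  \<open>K' = a K + 2 (a - \<mu>) exp (2 \<mu> y) f'\<close>, \<open>K 0 = 0\<close>. So \<open>G\<close> is continuous with
  exponential growth, whatever the sign of \<open>\<nu>\<close>.

  Uniqueness. No maximum principle is available for \<open>u\<close> itself when \<open>\<nu> < 0\<close>, but \<open>w = u\<^sub>x\<close> satisfies
  the same equation with the Robin condition \<open>w\<^sub>x = 2 (\<nu> - \<mu>) w\<close>, and the quotient of \<open>w\<close> by a
  strict supersolution that grows at infinity cannot attain a positive maximum. Hence two solutions differ
  by a function of \<open>t\<close> alone, which vanishes because both decay at infinity.
\<close>

section \<open>Integrals depending on a parameter\<close>

text \<open>In a first countable space continuity can be tested along sequences, which reduces the
  claim to dominated convergence.\<close>

lemma continuous_on_integral_dominated:
  fixes f :: "'a::{first_countable_topology, t2_space} \<Rightarrow> 'b \<Rightarrow> real"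
  assumes cont: "\<And>y. continuous_on S (\<lambda>p. f p y)"
    and meas: "\<And>p. p \<in> S \<Longrightarrow> f p \<in> borel_measurable M"
    and bound: "\<And>p y. p \<in> S \<Longrightarrow> \<bar>f p y\<bar> \<le> g y"
    and g: "integrable M g"
  shows "continuous_on S (\<lambda>p. \<integral>y. f p y \<partial>M)"
proof (rule continuous_on_sequentiallyI)
  fix u a assume u: "\<forall>n. u n \<in> S" and a: "a \<in> S" and lim: "u \<longlonglongrightarrow> a"
  show "(\<lambda>n. \<integral>y. f (u n) y \<partial>M) \<longlonglongrightarrow> (\<integral>y. f a y \<partial>M)"
  proof (rule integral_dominated_convergence[where w=g])
    show "AE y in M. (\<lambda>n. f (u n) y) \<longlonglongrightarrow> f a y"
      using cont u a lim unfolding continuous_on_sequentially comp_def by blast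
  qed (use u a meas bound g in auto)
qed

text \<open>The mean value inequality on the convex set \<open>S\<close> bounds all difference
  quotients by \<open>g\<close>, so dominated convergence applies along every sequence tending to
  \<open>x\<close>. Working within \<open>S\<close> allows a majorant that is only local.\<close>

lemma has_real_derivative_integral_dominated:
  fixes f f' :: "real \<Rightarrow> 'b \<Rightarrow> real"
  assumes deriv: "\<And>s y. s \<in> S \<Longrightarrow> ((\<lambda>s. f s y) has_real_derivative f' s y) (at s within S)"
    and bound: "\<And>s y. s \<in> S \<Longrightarrow> \<bar>f' s y\<bar> \<le> g y"
    and g: "integrable M g"
    and int: "\<And>s. s \<in> S \<Longrightarrow> integrable M (f s)"
    and meas: "f' x \<in> borel_measurable M"
    and S: "convex S" "x \<in> S"
  shows "((\<lambda>s. \<integral>y. f s y \<partial>M) has_real_derivative (\<integral>y. f' x y \<partial>M)) (at x within S)"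
  unfolding has_field_derivative_iff tendsto_at_iff_sequentially comp_def
proof (intro allI impI)
  fix X assume X: "\<forall>i. X i \<in> S - {x}" and lim: "X \<longlonglongrightarrow> x"
  have "(\<lambda>i. \<integral>y. (f (X i) y - f x y) / (X i - x) \<partial>M) \<longlonglongrightarrow> (\<integral>y. f' x y \<partial>M)"
  proof (rule integral_dominated_convergence[where w=g])
    show "AE y in M. (\<lambda>i. (f (X i) y - f x y) / (X i - x)) \<longlonglongrightarrow> f' x y"
      using deriv[OF S(2)] X lim
      unfolding has_field_derivative_iff tendsto_at_iff_sequentially comp_def by blast
    show "AE y in M. norm ((f (X i) y - f x y) / (X i - x)) \<le> g y" for i
    proof (rule AE_I2)
      fix y
      have "norm (f (X i) y - f x y) \<le> g y * norm (X i - x)"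
        using deriv bound X S by (intro field_differentiable_bound[of S _ "\<lambda>s. f' s y"]) auto
      then show "norm ((f (X i) y - f x y) / (X i - x)) \<le> g y"
        using X by (simp add: divide_simps)
    qed
    show "(\<lambda>y. (f (X i) y - f x y) / (X i - x)) \<in> borel_measurable M" for i
      using int[of "X i"] int[OF S(2)] X by auto
  qed (use meas g in auto)
  moreover have eq: "(\<integral>y. (f (X i) y - f x y) / (X i - x) \<partial>M)
      = ((\<integral>y. f (X i) y \<partial>M) - (\<integral>y. f x y \<partial>M)) / (X i - x)" for i
    using int[of "X i"] int[OF S(2)] X by (simp add: Bochner_Integration.integral_diff)
  ultimately show "(\<lambda>i. ((\<integral>y. f (X i) y \<partial>M) - (\<integral>y. f x y \<partial>M)) / (X i - x)) \<longlonglongrightarrow> (\<integral>y. f' x y \<partial>M)"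
    unfolding eq by simp
qed

section \<open>Gaussian moments\<close>

text \<open>Up to a constant, this is the majorant of all the Gaussian integrals below.\<close>

lemma integrable_exp_minus_abs: "integrable lborel (\<lambda>x::real. exp (- \<bar>x\<bar>))"
proof -
  have "(\<lambda>x. exp (- x) :: real) absolutely_integrable_on {0..}"
    using integrable_on_exp_minus_to_infinity[of 1 0]
    by (intro nonnegative_absolutely_integrable_1) auto
  then have A: "integrable lborel (\<lambda>x::real. indicator {0..} x * exp (- x))"
    unfolding set_integrable_def by (simp add: integrable_completion)
  have B: "integrable lborel (\<lambda>x::real. indicator {0..} (- x) * exp x)"
    using lborel_integrable_real_affine[OF A, of "-1" 0] by simp
  \<comment> \<open>At 0 both half-line indicators are 1, so the sum of the two integrable pieces
    only dominates the function, which is enough.\<close>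
  show ?thesis
    by (rule Bochner_Integration.integrable_bound[OF Bochner_Integration.integrable_add[OF A B]])
       (auto simp: indicator_def)
qed

text \<open>Completing the square trades the Gaussian for exponential decay of rate
  \<open>c + 2\<close>. One unit of the rate pays for the power. The remaining \<open>c + 1\<close>
  absorbs growth of rate \<open>c\<close> in the data and leaves one unit for integrability.\<close>

lemma abs_power_mult_exp_le:
  fixes p c t T :: real
  assumes "0 < t" "t \<le> T" "0 \<le> c"
  shows "\<bar>p\<bar> ^ j * exp (- p\<^sup>2 / (2 * t)) \<le> fact j * exp (T * (c + 2)\<^sup>2 / 2) * exp (- ((c + 1) * \<bar>p\<bar>))"
proof -
  \<comment> \<open>A single term of the exponential series is at most its sum.\<close>
  have "\<bar>p\<bar> ^ j / fact j \<le> exp \<bar>p\<bar>"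
    using sum_le_suminf[of "\<lambda>n. \<bar>p\<bar> ^ n /\<^sub>R fact n" "{j}"] summable_exp_generic[of "\<bar>p\<bar>"]
    by (auto simp: exp_def divide_inverse mult.commute)
  then have 1: "\<bar>p\<bar> ^ j \<le> fact j * exp \<bar>p\<bar>" by (simp add: field_simps)
  have "0 \<le> (T * (c + 2) - \<bar>p\<bar>)\<^sup>2 / (2 * T)" using assms by auto
  also have "\<dots> = T * (c + 2)\<^sup>2 / 2 - (c + 2) * \<bar>p\<bar> + p\<^sup>2 / (2 * T)"
    using assms by (simp add: field_simps power2_eq_square)
  finally have "- (p\<^sup>2 / (2 * T)) \<le> T * (c + 2)\<^sup>2 / 2 - (c + 2) * \<bar>p\<bar>" by simp
  moreover have "p\<^sup>2 / (2 * T) \<le> p\<^sup>2 / (2 * t)" using assms by (intro divide_left_mono) auto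
  ultimately have "- p\<^sup>2 / (2 * t) \<le> T * (c + 2)\<^sup>2 / 2 - (c + 2) * \<bar>p\<bar>" by simp
  then have 2: "exp (- p\<^sup>2 / (2 * t)) \<le> exp (T * (c + 2)\<^sup>2 / 2 - (c + 2) * \<bar>p\<bar>)" by simp
  have "\<bar>p\<bar> ^ j * exp (- p\<^sup>2 / (2 * t)) \<le> (fact j * exp \<bar>p\<bar>) * exp (T * (c + 2)\<^sup>2 / 2 - (c + 2) * \<bar>p\<bar>)"
    by (intro mult_mono 1 2) auto
  also have "\<dots> = fact j * exp (T * (c + 2)\<^sup>2 / 2) * exp (- ((c + 1) * \<bar>p\<bar>))"
    by (simp add: exp_add[symmetric] algebra_simps)
  finally show ?thesis .
qed

text \<open>The kernel is the Gaussian of mean \<open>x + \<mu> * t\<close> and variance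
  \<open>t\<close> without its normalising factor. Derivatives in \<open>x\<close> and
  \<open>t\<close> fall on the kernel and turn a moment into a combination of moments with powers of
  \<open>t\<close> as coefficients.\<close>

definition gauss_moment :: "(real \<Rightarrow> real) \<Rightarrow> real \<Rightarrow> nat \<Rightarrow> real \<Rightarrow> real \<Rightarrow> real" where
  "gauss_moment F \<mu> j t x =
     (\<integral>y. F y * ((y - x - \<mu> * t) ^ j * exp (- (y - x - \<mu> * t)\<^sup>2 / (2 * t))) \<partial>lborel)"

text \<open>The growth condition is one-sided: the reflected extension may grow exponentially at
  minus infinity, while boundedness on the right half line is what makes the solution bounded in
  \<open>x\<close>.\<close>

definition exp_bounded :: "(real \<Rightarrow> real) \<Rightarrow> bool" where
  "exp_bounded F \<longleftrightarrow> continuous_on UNIV F \<and>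
     (\<exists>C c. 0 \<le> C \<and> 0 \<le> c \<and> (\<forall>y. \<bar>F y\<bar> \<le> C * (1 + exp (- (c * y)))))"

text \<open>The one-sided bound serves estimates uniform in all large \<open>x\<close>; the cruder
  symmetric bound serves estimates that are local in \<open>x\<close>.\<close>

lemma exp_boundedD:
  assumes "exp_bounded F"
  obtains C c where "0 \<le> C" "0 \<le> c" "\<And>y. \<bar>F y\<bar> \<le> C * (1 + exp (- (c * y)))"
    "\<And>y. \<bar>F y\<bar> \<le> 2 * C * exp (c * \<bar>y\<bar>)"
proof -
  from assms obtain C c where *: "0 \<le> C" "0 \<le> c" "\<And>y. \<bar>F y\<bar> \<le> C * (1 + exp (- (c * y)))"
    unfolding exp_bounded_def by blast
  have "\<bar>F y\<bar> \<le> 2 * C * exp (c * \<bar>y\<bar>)" for y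
  proof -
    have "- (c * y) \<le> c * \<bar>y\<bar>" using mult_left_mono[of "-y" "\<bar>y\<bar>" c] *(2) by simp
    then have "exp (- (c * y)) \<le> exp (c * \<bar>y\<bar>)" by simp
    moreover have "1 \<le> exp (c * \<bar>y\<bar>)" using * by simp
    ultimately have "1 + exp (- (c * y)) \<le> 2 * exp (c * \<bar>y\<bar>)" by linarith
    then have "C * (1 + exp (- (c * y))) \<le> C * (2 * exp (c * \<bar>y\<bar>))" by (intro mult_left_mono *)
    with *(3)[of y] show ?thesis by (simp add: mult.assoc mult.left_commute)
  qed
  with * that show thesis by blast
qed

lemma exp_bounded_measurable: "exp_bounded F \<Longrightarrow> F \<in> borel_measurable borel"
  unfolding exp_bounded_def by (auto intro: borel_measurable_continuous_onI)

text \<open>If the mean stays in \<open>[-R, R]\<close>, then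
  \<open>\<bar>y\<bar> - R \<le> \<bar>p\<bar>\<close> for the deviation \<open>p\<close> from the
  mean. Decay in \<open>p\<close> becomes decay in \<open>y\<close> at the price of the factor
  \<open>exp ((c + 1) * R)\<close>, and the growth of \<open>F\<close> uses up \<open>c\<close> of
  the rate \<open>c + 1\<close>. The resulting majorant is common to all such \<open>t\<close> and
  \<open>x\<close>.\<close>

lemma gauss_integrand_bound:
  assumes "exp_bounded F" "0 \<le> R"
  obtains M where "0 \<le> M" "\<And>t x y. 0 < t \<Longrightarrow> t \<le> T \<Longrightarrow> \<bar>x + \<mu> * t\<bar> \<le> R \<Longrightarrow>
    \<bar>F y * ((y - x - \<mu> * t) ^ j * exp (- (y - x - \<mu> * t)\<^sup>2 / (2 * t)))\<bar> \<le> M * exp (- \<bar>y\<bar>)"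
proof -
  from exp_boundedD[OF assms(1)] obtain C c where *: "0 \<le> C" "0 \<le> c" "\<And>y. \<bar>F y\<bar> \<le> 2 * C * exp (c * \<bar>y\<bar>)"
    by metis
  define M where "M = 2 * C * (fact j * exp (T * (c + 2)\<^sup>2 / 2)) * exp ((c + 1) * R)"
  show thesis
  proof (rule that[of M])
    show "0 \<le> M" using * unfolding M_def by simp
    fix t x y :: real assume t: "0 < t" "t \<le> T" and x: "\<bar>x + \<mu> * t\<bar> \<le> R"
    define p where "p = y - x - \<mu> * t"
    have "\<bar>y\<bar> - R \<le> \<bar>p\<bar>" unfolding p_def using x by linarith
    then have "(c + 1) * (\<bar>y\<bar> - R) \<le> (c + 1) * \<bar>p\<bar>" using * by (intro mult_left_mono) auto
    then have "- ((c + 1) * \<bar>p\<bar>) \<le> (c + 1) * R - (c + 1) * \<bar>y\<bar>" by (simp add: algebra_simps)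
    then have e: "exp (- ((c + 1) * \<bar>p\<bar>)) \<le> exp ((c + 1) * R - (c + 1) * \<bar>y\<bar>)" by simp
    have "\<bar>F y * (p ^ j * exp (- p\<^sup>2 / (2 * t)))\<bar> = \<bar>F y\<bar> * (\<bar>p\<bar> ^ j * exp (- p\<^sup>2 / (2 * t)))"
      by (simp add: abs_mult power_abs)
    also have "\<dots> \<le> (2 * C * exp (c * \<bar>y\<bar>)) *
        (fact j * exp (T * (c + 2)\<^sup>2 / 2) * exp ((c + 1) * R - (c + 1) * \<bar>y\<bar>))"
    proof (rule mult_mono)
      show "\<bar>F y\<bar> \<le> 2 * C * exp (c * \<bar>y\<bar>)" by (rule *(3))
      have "\<bar>p\<bar> ^ j * exp (- p\<^sup>2 / (2 * t)) \<le> fact j * exp (T * (c + 2)\<^sup>2 / 2) * exp (- ((c + 1) * \<bar>p\<bar>))"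
        by (rule abs_power_mult_exp_le[OF t *(2)])
      also have "\<dots> \<le> fact j * exp (T * (c + 2)\<^sup>2 / 2) * exp ((c + 1) * R - (c + 1) * \<bar>y\<bar>)"
        by (intro mult_left_mono e) auto
      finally show "\<bar>p\<bar> ^ j * exp (- p\<^sup>2 / (2 * t))
          \<le> fact j * exp (T * (c + 2)\<^sup>2 / 2) * exp ((c + 1) * R - (c + 1) * \<bar>y\<bar>)" .
    qed (use * in auto)
    also have "\<dots> = 2 * C * (fact j * exp (T * (c + 2)\<^sup>2 / 2))
        * (exp (c * \<bar>y\<bar>) * exp ((c + 1) * R - (c + 1) * \<bar>y\<bar>))"
      by (simp add: mult_ac)
    also have "exp (c * \<bar>y\<bar>) * exp ((c + 1) * R - (c + 1) * \<bar>y\<bar>) = exp ((c + 1) * R) * exp (- \<bar>y\<bar>)"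
      by (simp add: exp_add[symmetric] algebra_simps)
    finally show "\<bar>F y * ((y - x - \<mu> * t) ^ j * exp (- (y - x - \<mu> * t)\<^sup>2 / (2 * t)))\<bar> \<le> M * exp (- \<bar>y\<bar>)"
      unfolding M_def p_def by (simp add: mult_ac)
  qed
qed

lemma integrable_gauss_integrand:
  assumes F: "exp_bounded F" and t: "0 < t"
  shows "integrable lborel (\<lambda>y. F y * ((y - x - \<mu> * t) ^ j * exp (- (y - x - \<mu> * t)\<^sup>2 / (2 * t))))"
proof -
  note [measurable] = exp_bounded_measurable[OF F]
  obtain M where M: "0 \<le> M" "\<And>y. \<bar>F y * ((y - x - \<mu> * t) ^ j * exp (- (y - x - \<mu> * t)\<^sup>2 / (2 * t)))\<bar> \<le> M * exp (- \<bar>y\<bar>)"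
    using gauss_integrand_bound[OF F, of "\<bar>x + \<mu> * t\<bar>" t \<mu> j] t by (metis abs_ge_zero order_refl)
  show ?thesis
  proof (rule Bochner_Integration.integrable_bound[of _ "\<lambda>y. M * exp (- \<bar>y\<bar>)"])
    show "integrable lborel (\<lambda>y. M * exp (- \<bar>y\<bar>))"
      using integrable_exp_minus_abs by simp
  qed (use M in auto)
qed

text \<open>Continuity is local, so the open half plane is exhausted by open bounded boxes, on each
  of which the means are bounded and one majorant suffices.\<close>

lemma continuous_on_gauss_moment:
  assumes F: "exp_bounded F"
  shows "continuous_on ({0<..} \<times> UNIV) (\<lambda>(t, x). gauss_moment F \<mu> j t x)"
proof -
  note [measurable] = exp_bounded_measurable[OF F]
  let ?U = "\<lambda>n. {1 / real (Suc n)<..<real (Suc n)} \<times> {- real (Suc n)<..<real (Suc n)}"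
  have "continuous_on (\<Union>n. ?U n) (\<lambda>(t, x). gauss_moment F \<mu> j t x)"
  proof (rule continuous_on_open_UN)
    fix n
    define T where "T = real (Suc n)"
    have T: "0 < T" unfolding T_def by simp
    obtain M where M: "0 \<le> M" "\<And>t x y. 0 < t \<Longrightarrow> t \<le> T \<Longrightarrow> \<bar>x + \<mu> * t\<bar> \<le> T + \<bar>\<mu>\<bar> * T \<Longrightarrow>
        \<bar>F y * ((y - x - \<mu> * t) ^ j * exp (- (y - x - \<mu> * t)\<^sup>2 / (2 * t)))\<bar> \<le> M * exp (- \<bar>y\<bar>)"
      using gauss_integrand_bound[OF F, of "T + \<bar>\<mu>\<bar> * T" T \<mu> j] T by (metis abs_ge_zero add_nonneg_nonneg less_imp_le mult_nonneg_nonneg)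
    have "continuous_on ({1 / T<..<T} \<times> {- T<..<T}) (\<lambda>p. \<integral>y. (case p of (t, x) \<Rightarrow>
        F y * ((y - x - \<mu> * t) ^ j * exp (- (y - x - \<mu> * t)\<^sup>2 / (2 * t)))) \<partial>lborel)"
    proof (rule continuous_on_integral_dominated)
      show "continuous_on ({1 / T<..<T} \<times> {- T<..<T}) (\<lambda>p. case p of (t, x) \<Rightarrow>
          F y * ((y - x - \<mu> * t) ^ j * exp (- (y - x - \<mu> * t)\<^sup>2 / (2 * t))))" for y
      proof -
        have "fst p \<noteq> 0" if "p \<in> {1 / T<..<T} \<times> {- T<..<T}" for p
          using that T by (auto simp: divide_simps)
        then show ?thesis unfolding case_prod_beta by (intro continuous_intros) auto
      qed
      show "integrable lborel (\<lambda>y. M * exp (- \<bar>y\<bar>))" using integrable_exp_minus_abs by simp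
      fix p :: "real \<times> real" and y assume p: "p \<in> {1 / T<..<T} \<times> {- T<..<T}"
      obtain t x where tx: "p = (t, x)" by force
      have "0 < 1 / T" using T by simp
      have "1 / T < t" "t \<le> T" and x: "\<bar>x\<bar> \<le> T" using p tx by auto
      with \<open>0 < 1 / T\<close> have t: "0 < t" "t \<le> T" by linarith+
      have "\<bar>\<mu> * t\<bar> \<le> \<bar>\<mu>\<bar> * T" using t by (auto simp: abs_mult intro!: mult_left_mono)
      then have "\<bar>x + \<mu> * t\<bar> \<le> T + \<bar>\<mu>\<bar> * T" using x by linarith
      from M(2)[OF t this] tx show "\<bar>case p of (t, x) \<Rightarrow>
          F y * ((y - x - \<mu> * t) ^ j * exp (- (y - x - \<mu> * t)\<^sup>2 / (2 * t)))\<bar> \<le> M * exp (- \<bar>y\<bar>)" by simp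
    qed auto
    then show "continuous_on (?U n) (\<lambda>(t, x). gauss_moment F \<mu> j t x)"
      unfolding T_def gauss_moment_def by (simp add: case_prod_beta)
  qed (auto intro: open_Times)
  moreover have "(\<Union>n. ?U n) = {0<..} \<times> UNIV"
  proof (intro equalityI subsetI)
    fix p assume p: "p \<in> {0::real<..} \<times> (UNIV::real set)"
    obtain t x where tx: "p = (t, x)" by force
    obtain n where n: "max (max t (1/t)) \<bar>x\<bar> < real n" using reals_Archimedean2 by blast
    have "1/t < real (Suc n)" using n by linarith
    then have "1 / real (Suc n) < t" using p tx by (auto simp: field_simps)
    then have "p \<in> ?U n" using n tx by auto
    then show "p \<in> (\<Union>n. ?U n)" by blast
  next
    fix p assume "p \<in> (\<Union>n. ?U n)"
    then obtain n where "1 / real (Suc n) < fst p" by auto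
    moreover have "0 < 1 / real (Suc n)" by simp
    ultimately have "0 < fst p" by linarith
    then show "p \<in> {0<..} \<times> UNIV" by (cases p) auto
  qed
  ultimately show ?thesis by simp
qed

text \<open>Differentiating the power lowers the order and differentiating the exponential raises
  it. For \<open>j = 0\<close> the truncated index \<open>j - 1\<close> is harmless, since its
  coefficient \<open>real j\<close> is 0.\<close>

lemma gauss_moment_deriv_x:
  assumes F: "exp_bounded F" and t: "0 < t"
  shows "((\<lambda>x. gauss_moment F \<mu> j t x) has_real_derivative
    - real j * gauss_moment F \<mu> (j - 1) t x + gauss_moment F \<mu> (Suc j) t x / t) (at x)"
proof -
  define k where "k i x y = F y * ((y - x - \<mu> * t) ^ i * exp (- (y - x - \<mu> * t)\<^sup>2 / (2 * t)))" for i x y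
  have k: "integrable lborel (k i x)" for i x
    unfolding k_def by (rule integrable_gauss_integrand[OF F t])
  \<comment> \<open>Bounds the mean \<open>s + \<mu> * t\<close> for every \<open>s\<close> within
    distance 1 of \<open>x\<close>.\<close>
  define R where "R = \<bar>x\<bar> + 1 + \<bar>\<mu>\<bar> * t"
  have R: "0 \<le> R" using t unfolding R_def by auto
  have bd: "\<exists>M\<ge>0. \<forall>s\<in>{x-1<..<x+1}. \<forall>y. \<bar>k i s y\<bar> \<le> M * exp (- \<bar>y\<bar>)" for i
  proof -
    obtain M where M: "0 \<le> M" "\<And>s x y. 0 < s \<Longrightarrow> s \<le> t \<Longrightarrow> \<bar>x + \<mu> * s\<bar> \<le> R \<Longrightarrow>
        \<bar>F y * ((y - x - \<mu> * s) ^ i * exp (- (y - x - \<mu> * s)\<^sup>2 / (2 * s)))\<bar> \<le> M * exp (- \<bar>y\<bar>)"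
      using gauss_integrand_bound[OF F R, of t \<mu> i] by metis
    have "\<bar>s + \<mu> * t\<bar> \<le> R" if "s \<in> {x-1<..<x+1}" for s
    proof -
      have "\<bar>\<mu> * t\<bar> = \<bar>\<mu>\<bar> * t" using t by (simp add: abs_mult)
      then show ?thesis using that unfolding R_def by auto
    qed
    then show ?thesis using M t unfolding k_def by (intro exI[of _ M]) auto
  qed
  obtain M1 where M1: "M1 \<ge> 0" "\<And>s y. s \<in> {x-1<..<x+1} \<Longrightarrow> \<bar>k (j - 1) s y\<bar> \<le> M1 * exp (- \<bar>y\<bar>)"
    using bd[of "j - 1"] by blast
  obtain M2 where M2: "M2 \<ge> 0" "\<And>s y. s \<in> {x-1<..<x+1} \<Longrightarrow> \<bar>k (Suc j) s y\<bar> \<le> M2 * exp (- \<bar>y\<bar>)"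
    using bd[of "Suc j"] by blast
  have "((\<lambda>x. \<integral>y. k j x y \<partial>lborel) has_real_derivative
      (\<integral>y. - real j * k (j - 1) x y + k (Suc j) x y / t \<partial>lborel)) (at x within {x-1<..<x+1})"
  proof (rule has_real_derivative_integral_dominated[where g="\<lambda>y. real j * (M1 * exp (- \<bar>y\<bar>)) + M2 * exp (- \<bar>y\<bar>) / t"])
    fix s y assume s: "s \<in> {x-1<..<x+1}"
    show "((\<lambda>s. k j s y) has_real_derivative - real j * k (j - 1) s y + k (Suc j) s y / t) (at s within {x-1<..<x+1})"
      unfolding k_def using t
      by (auto intro!: derivative_eq_intros simp: field_simps power2_eq_square)
    have "\<bar>- real j * k (j - 1) s y + k (Suc j) s y / t\<bar> \<le> \<bar>- real j * k (j - 1) s y\<bar> + \<bar>k (Suc j) s y / t\<bar>"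
      by (rule abs_triangle_ineq)
    also have "\<dots> = real j * \<bar>k (j - 1) s y\<bar> + \<bar>k (Suc j) s y\<bar> / t"
      using t by (simp add: abs_mult)
    also have "\<dots> \<le> real j * (M1 * exp (- \<bar>y\<bar>)) + M2 * exp (- \<bar>y\<bar>) / t"
      using M1(2)[OF s, of y] M2(2)[OF s, of y] t by (intro add_mono mult_left_mono divide_right_mono) auto
    finally show "\<bar>- real j * k (j - 1) s y + k (Suc j) s y / t\<bar> \<le> \<dots>" .
  qed (use k integrable_exp_minus_abs in auto)
  moreover have "(\<integral>y. - real j * k (j - 1) x y + k (Suc j) x y / t \<partial>lborel)
      = - real j * (\<integral>y. k (j - 1) x y \<partial>lborel) + (\<integral>y. k (Suc j) x y \<partial>lborel) / t"
    using k by simp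
  ultimately show ?thesis
    unfolding gauss_moment_def k_def by (simp add: at_within_open[of _ "{x-1<..<x+1}"])
qed

text \<open>Time enters through the mean, which gives the two terms with factor
  \<open>\<mu>\<close>, and through the variance, which raises the order by two.\<close>

lemma gauss_moment_deriv_t:
  assumes F: "exp_bounded F" and t: "0 < t"
  shows "((\<lambda>t. gauss_moment F \<mu> j t x) has_real_derivative
    - \<mu> * real j * gauss_moment F \<mu> (j - 1) t x + \<mu> * gauss_moment F \<mu> (Suc j) t x / t
      + gauss_moment F \<mu> (Suc (Suc j)) t x / (2 * t\<^sup>2)) (at t)"
proof -
  define k where "k i t y = F y * ((y - x - \<mu> * t) ^ i * exp (- (y - x - \<mu> * t)\<^sup>2 / (2 * t)))" for i t y
  have k: "integrable lborel (k i s)" if "0 < s" for i s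
    unfolding k_def by (rule integrable_gauss_integrand[OF F that])
  \<comment> \<open>On this window \<open>1 / s\<close> and \<open>1 / s\<^sup>2\<close> are at most
    their values at \<open>t / 2\<close>, and the means stay bounded.\<close>
  let ?S = "{t/2<..<2*t}"
  define R where "R = \<bar>x\<bar> + \<bar>\<mu>\<bar> * (2 * t)"
  have R: "0 \<le> R" using t unfolding R_def by auto
  have bd: "\<exists>M\<ge>0. \<forall>s\<in>?S. \<forall>y. \<bar>k i s y\<bar> \<le> M * exp (- \<bar>y\<bar>)" for i
  proof -
    obtain M where M: "0 \<le> M" "\<And>s x y. 0 < s \<Longrightarrow> s \<le> 2 * t \<Longrightarrow> \<bar>x + \<mu> * s\<bar> \<le> R \<Longrightarrow>
        \<bar>F y * ((y - x - \<mu> * s) ^ i * exp (- (y - x - \<mu> * s)\<^sup>2 / (2 * s)))\<bar> \<le> M * exp (- \<bar>y\<bar>)"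
      using gauss_integrand_bound[OF F R, of "2 * t" \<mu> i] by metis
    have "\<bar>x + \<mu> * s\<bar> \<le> R" if "s \<in> ?S" for s
    proof -
      have "\<bar>\<mu> * s\<bar> \<le> \<bar>\<mu>\<bar> * (2 * t)" using t that by (auto simp: abs_mult intro!: mult_left_mono)
      then show ?thesis using that unfolding R_def by auto
    qed
    then show ?thesis using M t unfolding k_def by (intro exI[of _ M]) auto
  qed
  obtain M1 where M1: "M1 \<ge> 0" "\<And>s y. s \<in> ?S \<Longrightarrow> \<bar>k (j - 1) s y\<bar> \<le> M1 * exp (- \<bar>y\<bar>)"
    using bd[of "j - 1"] by blast
  obtain M2 where M2: "M2 \<ge> 0" "\<And>s y. s \<in> ?S \<Longrightarrow> \<bar>k (Suc j) s y\<bar> \<le> M2 * exp (- \<bar>y\<bar>)"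
    using bd[of "Suc j"] by blast
  obtain M3 where M3: "M3 \<ge> 0" "\<And>s y. s \<in> ?S \<Longrightarrow> \<bar>k (Suc (Suc j)) s y\<bar> \<le> M3 * exp (- \<bar>y\<bar>)"
    using bd[of "Suc (Suc j)"] by blast
  let ?k' = "\<lambda>s y. - (\<mu> * real j) * k (j - 1) s y + \<mu> / s * k (Suc j) s y + 1 / (2 * s\<^sup>2) * k (Suc (Suc j)) s y"
  have "((\<lambda>t. \<integral>y. k j t y \<partial>lborel) has_real_derivative (\<integral>y. ?k' t y \<partial>lborel)) (at t within ?S)"
  proof (rule has_real_derivative_integral_dominated[where g="\<lambda>y. \<bar>\<mu> * real j\<bar> * (M1 * exp (- \<bar>y\<bar>))
        + \<bar>\<mu>\<bar> / (t / 2) * (M2 * exp (- \<bar>y\<bar>)) + 1 / (2 * (t / 2)\<^sup>2) * (M3 * exp (- \<bar>y\<bar>))"])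
    fix s y assume s: "s \<in> ?S"
    then have s0: "0 < s" "t / 2 \<le> s" using t by auto
    show "((\<lambda>s. k j s y) has_real_derivative ?k' s y) (at s within ?S)"
      unfolding k_def using s0
      by (auto intro!: derivative_eq_intros simp: field_simps power2_eq_square)
    have "\<bar>?k' s y\<bar> \<le> \<bar>- (\<mu> * real j) * k (j - 1) s y\<bar> + \<bar>\<mu> / s * k (Suc j) s y\<bar> + \<bar>1 / (2 * s\<^sup>2) * k (Suc (Suc j)) s y\<bar>"
      by linarith
    also have "\<dots> = \<bar>\<mu> * real j\<bar> * \<bar>k (j - 1) s y\<bar> + \<bar>\<mu>\<bar> / s * \<bar>k (Suc j) s y\<bar> + 1 / (2 * s\<^sup>2) * \<bar>k (Suc (Suc j)) s y\<bar>"
      using s0 by (simp add: abs_mult)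
    also have "\<dots> \<le> \<bar>\<mu> * real j\<bar> * (M1 * exp (- \<bar>y\<bar>))
        + \<bar>\<mu>\<bar> / (t / 2) * (M2 * exp (- \<bar>y\<bar>)) + 1 / (2 * (t / 2)\<^sup>2) * (M3 * exp (- \<bar>y\<bar>))"
      using M1(2)[OF s, of y] M2(2)[OF s, of y] M3(2)[OF s, of y] t s0
      by (intro add_mono mult_mono frac_le power_mono order_refl) auto
    finally show "\<bar>?k' s y\<bar> \<le> \<bar>\<mu> * real j\<bar> * (M1 * exp (- \<bar>y\<bar>))
        + \<bar>\<mu>\<bar> / (t / 2) * (M2 * exp (- \<bar>y\<bar>)) + 1 / (2 * (t / 2)\<^sup>2) * (M3 * exp (- \<bar>y\<bar>))" .
  next
    show "integrable lborel (k j s)" if "s \<in> ?S" for s using k[of s] that t by simp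
    show "?k' t \<in> borel_measurable lborel" using k[OF t] by simp
    show "integrable lborel (\<lambda>y. \<bar>\<mu> * real j\<bar> * (M1 * exp (- \<bar>y\<bar>))
        + \<bar>\<mu>\<bar> / (t / 2) * (M2 * exp (- \<bar>y\<bar>)) + 1 / (2 * (t / 2)\<^sup>2) * (M3 * exp (- \<bar>y\<bar>)))"
      by (intro Bochner_Integration.integrable_add integrable_mult_right integrable_exp_minus_abs)
    show "t \<in> ?S" using t by simp
  qed simp
  moreover have "(\<integral>y. ?k' t y \<partial>lborel)
      = - (\<mu> * real j) * (\<integral>y. k (j - 1) t y \<partial>lborel) + \<mu> / t * (\<integral>y. k (Suc j) t y \<partial>lborel)
        + 1 / (2 * t\<^sup>2) * (\<integral>y. k (Suc (Suc j)) t y \<partial>lborel)"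
    using k[OF t] by simp
  ultimately show ?thesis
    using t unfolding gauss_moment_def k_def by (simp add: at_within_open[of _ ?S])
qed

section \<open>Smoothness through a class closed under differentiation\<close>

text \<open>A class of continuous functions closed under both partial derivatives, which yields
  smoothness without computing iterated derivatives. The exponents are real because the normalised
  kernel carries \<open>t powr (-1/2)\<close>.\<close>

inductive gauss_span :: "(real \<Rightarrow> real) \<Rightarrow> real \<Rightarrow> (real \<Rightarrow> real \<Rightarrow> real) \<Rightarrow> bool" for F \<mu> where
  base: "gauss_span F \<mu> (\<lambda>t x. t powr r * gauss_moment F \<mu> j t x)"
| add: "gauss_span F \<mu> g \<Longrightarrow> gauss_span F \<mu> h \<Longrightarrow> gauss_span F \<mu> (\<lambda>t x. g t x + h t x)"
| scale: "gauss_span F \<mu> g \<Longrightarrow> gauss_span F \<mu> (\<lambda>t x. c * g t x)"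

lemma gauss_span_continuous:
  assumes "exp_bounded F" "gauss_span F \<mu> g"
  shows "continuous_on ({0<..} \<times> UNIV) (\<lambda>(t, x). g t x)"
  using assms(2)
proof induction
  case (base r j)
  have "continuous_on ({0<..} \<times> UNIV) (\<lambda>p :: real \<times> real. fst p powr r)"
    by (intro continuous_intros) auto
  then show ?case
    using continuous_on_mult[OF _ continuous_on_gauss_moment[OF assms(1)], of "\<lambda>p. fst p powr r" \<mu> j]
    by (simp add: case_prod_beta)
next
  case (add g h)
  then show ?case using continuous_on_add[of _ "\<lambda>(t, x). g t x" "\<lambda>(t, x). h t x"]
    by (simp add: case_prod_beta)
next
  case (scale g c)
  then show ?case using continuous_on_mult_left[of _ "\<lambda>(t, x). g t x" c]
    by (simp add: case_prod_beta)
qed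

lemma gauss_span_deriv_x:
  assumes F: "exp_bounded F" and "gauss_span F \<mu> g"
  shows "\<exists>h. gauss_span F \<mu> h \<and> (\<forall>t x. 0 < t \<longrightarrow> ((\<lambda>x. g t x) has_real_derivative h t x) (at x))"
  using assms(2)
proof induction
  case (base r j)
  let ?I = "gauss_moment F \<mu>"
  let ?h = "\<lambda>t x. (- real j) * (t powr r * ?I (j - 1) t x) + t powr (r - 1) * ?I (Suc j) t x"
  have "gauss_span F \<mu> ?h"
    by (intro gauss_span.intros)
  moreover have "((\<lambda>x. t powr r * ?I j t x) has_real_derivative ?h t x) (at x)" if "0 < t" for t x
    using gauss_moment_deriv_x[OF F that, THEN DERIV_cmult, of "t powr r" \<mu> j x] that
    by (simp add: field_simps powr_diff)
  ultimately show ?case by blast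
next
  case (add g h)
  from add.IH obtain g' h' where "gauss_span F \<mu> g'" "gauss_span F \<mu> h'"
    "\<And>t x. 0 < t \<Longrightarrow> ((\<lambda>x. g t x) has_real_derivative g' t x) (at x)"
    "\<And>t x. 0 < t \<Longrightarrow> ((\<lambda>x. h t x) has_real_derivative h' t x) (at x)" by blast
  then show ?case by (intro exI[of _ "\<lambda>t x. g' t x + h' t x"]) (auto intro: gauss_span.intros DERIV_add)
next
  case (scale g c)
  from scale.IH obtain g' where "gauss_span F \<mu> g'"
    "\<And>t x. 0 < t \<Longrightarrow> ((\<lambda>x. g t x) has_real_derivative g' t x) (at x)" by blast
  then show ?case by (intro exI[of _ "\<lambda>t x. c * g' t x"]) (auto intro: gauss_span.intros DERIV_cmult)
qed

lemma gauss_span_deriv_t: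
  assumes F: "exp_bounded F" and "gauss_span F \<mu> g"
  shows "\<exists>h. gauss_span F \<mu> h \<and> (\<forall>t x. 0 < t \<longrightarrow> ((\<lambda>t. g t x) has_real_derivative h t x) (at t))"
  using assms(2)
proof induction
  case (base r j)
  let ?I = "gauss_moment F \<mu>"
  let ?h = "\<lambda>t x. (r * (t powr (r - 1) * ?I j t x) + (- \<mu> * real j) * (t powr r * ?I (j - 1) t x))
      + (\<mu> * (t powr (r - 1) * ?I (Suc j) t x) + (1 / 2) * (t powr (r - 2) * ?I (Suc (Suc j)) t x))"
  have "gauss_span F \<mu> ?h"
    by (intro gauss_span.intros)
  moreover have "((\<lambda>t. t powr r * ?I j t x) has_real_derivative ?h t x) (at t)" if "0 < t" for t x
  proof -
    have "t powr (r - 2) = t powr r / t\<^sup>2" using that by (simp add: powr_diff)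
    then show ?thesis using that
      by (intro DERIV_cong[OF DERIV_mult[OF has_real_derivative_powr[OF that] gauss_moment_deriv_t[OF F that]]])
         (simp add: field_simps powr_diff power2_eq_square)
  qed
  ultimately show ?case by blast
next
  case (add g h)
  from add.IH obtain g' h' where "gauss_span F \<mu> g'" "gauss_span F \<mu> h'"
    "\<And>t x. 0 < t \<Longrightarrow> ((\<lambda>t. g t x) has_real_derivative g' t x) (at t)"
    "\<And>t x. 0 < t \<Longrightarrow> ((\<lambda>t. h t x) has_real_derivative h' t x) (at t)" by blast
  then show ?case by (intro exI[of _ "\<lambda>t x. g' t x + h' t x"]) (auto intro: gauss_span.intros DERIV_add)
next
  case (scale g c)
  from scale.IH obtain g' where "gauss_span F \<mu> g'"
    "\<And>t x. 0 < t \<Longrightarrow> ((\<lambda>t. g t x) has_real_derivative g' t x) (at t)" by blast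
  then show ?case by (intro exI[of _ "\<lambda>t x. c * g' t x"]) (auto intro: gauss_span.intros DERIV_cmult)
qed

text \<open>This makes derivatives within the closed half line unique, also at the boundary point
  0.\<close>

lemma at_within_half_line_neq_bot: "0 \<le> (x::real) \<Longrightarrow> at x within {0..} \<noteq> bot"
proof -
  assume "0 \<le> x"
  then have "x islimpt {x<..<x+1}" by (intro islimpt_greaterThanLessThan1) auto
  then have "x islimpt {0..}" using \<open>0 \<le> x\<close> by (rule_tac islimpt_subset) auto
  then show ?thesis by (simp add: trivial_limit_within)
qed

text \<open>If \<open>P\<close> is closed under both derivatives on \<open>S\<close> and its members
  are continuous there, every iterated derivative of \<open>u\<close> agrees on \<open>S\<close>
  with a member of \<open>P\<close>.\<close>

lemma smooth2_on_half_strip_if: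
  fixes u :: "real \<Rightarrow> real \<Rightarrow> real"
  defines "S \<equiv> {0<..} \<times> {0..}"
  assumes v: "P v" "\<And>t x. (t, x) \<in> S \<Longrightarrow> u t x = v t x"
    and cont: "\<And>g. P g \<Longrightarrow> continuous_on S (\<lambda>(t, x). g t x)"
    and dt: "\<And>g. P g \<Longrightarrow> \<exists>h. P h \<and> (\<forall>t x. (t, x) \<in> S \<longrightarrow> ((\<lambda>s. g s x) has_real_derivative h t x) (at t))"
    and dx: "\<And>g. P g \<Longrightarrow> \<exists>h. P h \<and> (\<forall>t x. (t, x) \<in> S \<longrightarrow> ((\<lambda>y. g t y) has_real_derivative h t x) (at x))"
  shows "smooth2_on S u"
proof -
  have slice: "{s. (s, x) \<in> S} = {0<..}" "{y. (t, y) \<in> S} = {0..}" "0 < t" "0 \<le> x" if "(t, x) \<in> S" for t x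
    using that unfolding S_def by auto
  have dt': "\<exists>h. P h \<and> (\<forall>t x. (t, x) \<in> S \<longrightarrow> ((\<lambda>s. g s x) has_real_derivative h t x) (at t within {s. (s, x) \<in> S}))"
    if g: "P g'" "\<And>t x. (t, x) \<in> S \<Longrightarrow> g t x = g' t x" for g g'
  proof -
    from dt[OF g(1)] obtain h where h: "P h"
      "\<And>t x. (t, x) \<in> S \<Longrightarrow> ((\<lambda>s. g' s x) has_real_derivative h t x) (at t)" by blast
    have "((\<lambda>s. g s x) has_real_derivative h t x) (at t within {s. (s, x) \<in> S})" if "(t, x) \<in> S" for t x
      by (rule has_field_derivative_transform_within[OF has_field_derivative_at_within[OF h(2)[OF that]], of 1])
         (use that g in auto)
    with h show ?thesis by blast
  qed
  have dx': "\<exists>h. P h \<and> (\<forall>t x. (t, x) \<in> S \<longrightarrow> ((\<lambda>y. g t y) has_real_derivative h t x) (at x within {y. (t, y) \<in> S}))"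
    if g: "P g'" "\<And>t x. (t, x) \<in> S \<Longrightarrow> g t x = g' t x" for g g'
  proof -
    from dx[OF g(1)] obtain h where h: "P h"
      "\<And>t x. (t, x) \<in> S \<Longrightarrow> ((\<lambda>y. g' t y) has_real_derivative h t x) (at x)" by blast
    have "((\<lambda>y. g t y) has_real_derivative h t x) (at x within {y. (t, y) \<in> S})" if "(t, x) \<in> S" for t x
      by (rule has_field_derivative_transform_within[OF has_field_derivative_at_within[OF h(2)[OF that]], of 1])
         (use that g in auto)
    with h show ?thesis by blast
  qed
  \<comment> \<open>The relation \<open>is_pderiv\<close> leaves values off \<open>S\<close>
    arbitrary, so the invariant is agreement on \<open>S\<close> only. Uniqueness of derivatives
    within the slices carries it through each differentiation.\<close>
  have rep: "\<exists>g'. P g' \<and> (\<forall>t x. (t, x) \<in> S \<longrightarrow> g t x = g' t x)" if "is_pderiv S u g" for g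
    using that
  proof induction
    case base
    then show ?case using v by blast
  next
    case (dt g h)
    then obtain g' where "P g'" "\<And>t x. (t, x) \<in> S \<Longrightarrow> g t x = g' t x" by blast
    from dt'[OF this] obtain h' where h': "P h'" "\<And>t x. (t, x) \<in> S \<Longrightarrow>
        ((\<lambda>s. g s x) has_real_derivative h' t x) (at t within {s. (s, x) \<in> S})" by blast
    have "h t x = h' t x" if tx: "(t, x) \<in> S" for t x
    proof (rule has_field_derivative_unique)
      show "at t within {s. (s, x) \<in> S} \<noteq> bot"
        using slice[OF tx] by (simp add: at_within_open[of t "{0<..}"])
    qed (use dt.hyps(2) h'(2) tx in blast)+
    with h' show ?case by blast
  next
    case (dx g h)
    then obtain g' where "P g'" "\<And>t x. (t, x) \<in> S \<Longrightarrow> g t x = g' t x" by blast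
    from dx'[OF this] obtain h' where h': "P h'" "\<And>t x. (t, x) \<in> S \<Longrightarrow>
        ((\<lambda>y. g t y) has_real_derivative h' t x) (at x within {y. (t, y) \<in> S})" by blast
    have "h t x = h' t x" if tx: "(t, x) \<in> S" for t x
    proof (rule has_field_derivative_unique)
      show "at x within {y. (t, y) \<in> S} \<noteq> bot"
        using slice[OF tx] at_within_half_line_neq_bot by simp
    qed (use dx.hyps(2) h'(2) tx in blast)+
    with h' show ?case by blast
  qed
  show ?thesis
    unfolding smooth2_on_def
  proof (intro allI impI conjI)
    fix g assume "is_pderiv S u g"
    from rep[OF this] obtain g' where g': "P g'" "\<And>t x. (t, x) \<in> S \<Longrightarrow> g t x = g' t x" by blast
    show "continuous_on S (\<lambda>(t, x). g t x)"
      using cont[OF g'(1)] by (rule continuous_on_eq) (use g'(2) in auto)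
    show "\<exists>h. \<forall>t x. (t, x) \<in> S \<longrightarrow> ((\<lambda>s. g s x) has_real_derivative h t x) (at t within {s. (s, x) \<in> S})"
      using dt'[OF g'] by blast
    show "\<exists>h. \<forall>t x. (t, x) \<in> S \<longrightarrow> ((\<lambda>y. g t y) has_real_derivative h t x) (at x within {y. (t, y) \<in> S})"
      using dx'[OF g'] by blast
  qed
qed

section \<open>The heat semigroup with drift\<close>

text \<open>With a standard normal integration variable the formula stays meaningful at
  \<open>t = 0\<close>, and the \<open>x\<close>-derivative falls on \<open>F\<close>. This form
  gives regularity up to the initial time; \<open>gauss_moment\<close> gives smoothness for positive
  times.\<close>

definition heat_mean :: "(real \<Rightarrow> real) \<Rightarrow> real \<Rightarrow> real \<Rightarrow> real \<Rightarrow> real" where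
  "heat_mean F \<mu> t x = (\<integral>z. F (x + \<mu> * t + sqrt t * z) * std_normal_density z \<partial>lborel)"

lemma heat_mean_0 [simp]: "heat_mean F \<mu> 0 x = F x"
proof -
  have "(\<integral>z. std_normal_density z \<partial>lborel) = 1"
    using integral_std_normal_moment_even[of 0] by simp
  then show ?thesis unfolding heat_mean_def by simp
qed

text \<open>The one-sided growth of \<open>F\<close> makes the majorant uniform over all
  \<open>x\<close> to the right of \<open>- X\<close> and all times down to 0.\<close>

lemma heat_mean_bound:
  assumes F: "exp_bounded F" and "0 \<le> T" "0 \<le> X"
  obtains M where "0 \<le> M" "\<And>t x z. 0 \<le> t \<Longrightarrow> t \<le> T \<Longrightarrow> - X \<le> x \<Longrightarrow>
    \<bar>F (x + \<mu> * t + sqrt t * z) * std_normal_density z\<bar> \<le> M * exp (- \<bar>z\<bar>)"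
proof -
  from exp_boundedD[OF F] obtain C c where *: "0 \<le> C" "0 \<le> c" "\<And>y. \<bar>F y\<bar> \<le> C * (1 + exp (- (c * y)))"
    by metis
  \<comment> \<open>\<open>d\<close> is the growth rate in \<open>z\<close> over times up to
    \<open>T\<close>, and \<open>A\<close> bounds the part of the exponent that does not depend on
    \<open>z\<close>.\<close>
  define d where "d = c * sqrt T"
  define A where "A = c * (X + \<bar>\<mu>\<bar> * T)"
  have d: "0 \<le> d" using * assms unfolding d_def by simp
  define M where "M = C * (1 + exp A) * exp ((d + 2)\<^sup>2 / 2)"
  show thesis
  proof (rule that[of M])
    show "0 \<le> M" using * unfolding M_def by (simp add: add_nonneg_nonneg)
    fix t x z :: real assume t: "0 \<le> t" "t \<le> T" and x: "- X \<le> x"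
    have "- (\<mu> * t) \<le> \<bar>\<mu>\<bar> * T"
    proof -
      have "- (\<mu> * t) \<le> \<bar>\<mu> * t\<bar>" by simp
      also have "\<dots> \<le> \<bar>\<mu>\<bar> * T" using t by (auto simp: abs_mult intro: mult_left_mono)
      finally show ?thesis .
    qed
    moreover have "- (sqrt t * z) \<le> sqrt T * \<bar>z\<bar>"
    proof -
      have "- (sqrt t * z) \<le> \<bar>sqrt t * z\<bar>" by simp
      also have "\<dots> = sqrt t * \<bar>z\<bar>" using t by (simp add: abs_mult)
      also have "\<dots> \<le> sqrt T * \<bar>z\<bar>" using t by (intro mult_right_mono) auto
      finally show ?thesis .
    qed
    ultimately have "- (x + \<mu> * t + sqrt t * z) \<le> X + \<bar>\<mu>\<bar> * T + sqrt T * \<bar>z\<bar>" using x by linarith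
    then have "c * - (x + \<mu> * t + sqrt t * z) \<le> c * (X + \<bar>\<mu>\<bar> * T + sqrt T * \<bar>z\<bar>)"
      by (intro mult_left_mono *)
    also have "\<dots> = A + d * \<bar>z\<bar>" unfolding A_def d_def by (simp add: algebra_simps)
    finally have "exp (- (c * (x + \<mu> * t + sqrt t * z))) \<le> exp (A + d * \<bar>z\<bar>)"
      by (simp only: mult_minus_right exp_le_cancel_iff)
    moreover have "1 \<le> exp (d * \<bar>z\<bar>)" using d by simp
    ultimately have e: "1 + exp (- (c * (x + \<mu> * t + sqrt t * z))) \<le> (1 + exp A) * exp (d * \<bar>z\<bar>)"
      unfolding exp_add distrib_right by linarith
    have F': "\<bar>F (x + \<mu> * t + sqrt t * z)\<bar> \<le> C * ((1 + exp A) * exp (d * \<bar>z\<bar>))"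
      by (rule order_trans[OF *(3)]) (intro mult_left_mono e *)
    have "1 / sqrt (2 * pi) \<le> 1" using pi_ge_two by simp
    then have "std_normal_density z \<le> exp (- z\<^sup>2 / 2)"
      unfolding std_normal_density_def by (intro mult_left_le_one_le) auto
    also have "\<dots> \<le> exp ((d + 2)\<^sup>2 / 2) * exp (- ((d + 1) * \<bar>z\<bar>))"
      using abs_power_mult_exp_le[of 1 1 d z 0] d by simp
    finally have \<phi>: "std_normal_density z \<le> exp ((d + 2)\<^sup>2 / 2) * exp (- ((d + 1) * \<bar>z\<bar>))" .
    have "\<bar>F (x + \<mu> * t + sqrt t * z) * std_normal_density z\<bar>
        = \<bar>F (x + \<mu> * t + sqrt t * z)\<bar> * std_normal_density z"
      by (simp add: abs_mult)
    also have "\<dots> \<le> (C * ((1 + exp A) * exp (d * \<bar>z\<bar>))) * (exp ((d + 2)\<^sup>2 / 2) * exp (- ((d + 1) * \<bar>z\<bar>)))"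
      using F' by (intro mult_mono F' \<phi>) auto
    also have "\<dots> = M * (exp (d * \<bar>z\<bar>) * exp (- ((d + 1) * \<bar>z\<bar>)))"
      unfolding M_def by (simp add: mult_ac)
    also have "exp (d * \<bar>z\<bar>) * exp (- ((d + 1) * \<bar>z\<bar>)) = exp (- \<bar>z\<bar>)"
      by (simp add: exp_add[symmetric] algebra_simps)
    finally show "\<bar>F (x + \<mu> * t + sqrt t * z) * std_normal_density z\<bar> \<le> M * exp (- \<bar>z\<bar>)" .
  qed
qed

lemma integrable_heat_mean:
  assumes F: "exp_bounded F" and "0 \<le> t"
  shows "integrable lborel (\<lambda>z. F (x + \<mu> * t + sqrt t * z) * std_normal_density z)"
proof -
  note [measurable] = exp_bounded_measurable[OF F]
  obtain M where M: "0 \<le> M" "\<And>r x' z. 0 \<le> r \<Longrightarrow> r \<le> t \<Longrightarrow> - \<bar>x\<bar> \<le> x' \<Longrightarrow>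
    \<bar>F (x' + \<mu> * r + sqrt r * z) * std_normal_density z\<bar> \<le> M * exp (- \<bar>z\<bar>)"
    by (rule heat_mean_bound[OF F assms(2), of "\<bar>x\<bar>" \<mu>]) auto
  then have "\<bar>F (x + \<mu> * t + sqrt t * z) * std_normal_density z\<bar> \<le> M * exp (- \<bar>z\<bar>)" for z
    using assms(2) by simp
  note M = M(1) this
  show ?thesis
    by (rule Bochner_Integration.integrable_bound[OF integrable_mult_right[OF integrable_exp_minus_abs, of M]])
       (use M in auto)
qed

text \<open>A single integrable majorant for the whole strip gives continuity by dominated
  convergence, and its integral bounds the function.\<close>

lemma Cb2_on_heat_mean:
  assumes F: "exp_bounded F" and T: "0 \<le> T"
  shows "Cb2_on ({0..T} \<times> {0..}) (heat_mean F \<mu>)"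
proof -
  have Fc: "continuous_on UNIV F" using F unfolding exp_bounded_def by blast
  note [measurable] = exp_bounded_measurable[OF F]
  obtain M where M: "0 \<le> M" "\<And>t x z. 0 \<le> t \<Longrightarrow> t \<le> T \<Longrightarrow> 0 \<le> x \<Longrightarrow>
    \<bar>F (x + \<mu> * t + sqrt t * z) * std_normal_density z\<bar> \<le> M * exp (- \<bar>z\<bar>)"
    by (rule heat_mean_bound[OF F T, of 0 \<mu>]) auto
  have int: "integrable lborel (\<lambda>z. M * exp (- \<bar>z\<bar>))" using integrable_exp_minus_abs by simp
  have "continuous_on ({0..T} \<times> {0..}) (\<lambda>p. \<integral>z. (case p of (t, x) \<Rightarrow>
      F (x + \<mu> * t + sqrt t * z) * std_normal_density z) \<partial>lborel)"
  proof (rule continuous_on_integral_dominated[OF _ _ _ int])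
    show "continuous_on ({0..T} \<times> {0..}) (\<lambda>p. case p of (t, x) \<Rightarrow>
      F (x + \<mu> * t + sqrt t * z) * std_normal_density z)" for z
      unfolding case_prod_beta
      by (intro continuous_intros continuous_on_compose2[OF Fc]) auto
  qed (use M in auto)
  moreover have "\<bar>heat_mean F \<mu> t x\<bar> \<le> (\<integral>z. M * exp (- \<bar>z\<bar>) \<partial>lborel)" if "0 \<le> t" "t \<le> T" "0 \<le> x" for t x
    unfolding heat_mean_def
    using Bochner_Integration.integral_norm_bound_integral[OF integrable_heat_mean[OF F that(1)] int, of x \<mu>] M(2)[OF that] by simp
  ultimately show ?thesis
    unfolding Cb2_on_def by (auto simp: heat_mean_def case_prod_beta bounded_iff
      intro!: exI[of _ "(\<integral>z. M * exp (- \<bar>z\<bar>) \<partial>lborel)"])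
qed

text \<open>Since the derivative falls on \<open>F\<close>, the gradient is again a heat mean,
  including at \<open>t = 0\<close>; continuity and boundedness of the gradient thus follow from
  those of heat means.\<close>

lemma heat_mean_deriv_x:
  assumes F: "exp_bounded F" and G: "exp_bounded G"
    and FG: "\<And>y. (F has_real_derivative G y) (at y)" and t: "0 \<le> t"
  shows "((\<lambda>x. heat_mean F \<mu> t x) has_real_derivative heat_mean G \<mu> t x) (at x)"
proof -
  note [measurable] = exp_bounded_measurable[OF G]
  let ?S = "{x-1<..<x+1}"
  obtain M where M: "0 \<le> M" "\<And>r x' z. 0 \<le> r \<Longrightarrow> r \<le> t \<Longrightarrow> - (\<bar>x\<bar> + 1) \<le> x' \<Longrightarrow>
    \<bar>G (x' + \<mu> * r + sqrt r * z) * std_normal_density z\<bar> \<le> M * exp (- \<bar>z\<bar>)"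
    by (rule heat_mean_bound[OF G t, of "\<bar>x\<bar> + 1" \<mu>]) auto
  have "((\<lambda>x. heat_mean F \<mu> t x) has_real_derivative heat_mean G \<mu> t x) (at x within ?S)"
    unfolding heat_mean_def
  proof (rule has_real_derivative_integral_dominated[where g="\<lambda>z. M * exp (- \<bar>z\<bar>)"])
    fix s z assume s: "s \<in> ?S"
    have "((\<lambda>s. s + \<mu> * t + sqrt t * z) has_real_derivative 1) (at s within ?S)"
      by (auto intro!: derivative_eq_intros)
    from DERIV_chain2[OF FG this]
    show "((\<lambda>s. F (s + \<mu> * t + sqrt t * z) * std_normal_density z) has_real_derivative
        G (s + \<mu> * t + sqrt t * z) * std_normal_density z) (at s within ?S)"
      by (auto intro: DERIV_cmult_right)
    show "\<bar>G (s + \<mu> * t + sqrt t * z) * std_normal_density z\<bar> \<le> M * exp (- \<bar>z\<bar>)"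
      using M(2)[of t s z] s t by auto
  qed (use integrable_heat_mean[OF F t] integrable_exp_minus_abs in auto)
  then show ?thesis by (simp add: at_within_open[of _ ?S])
qed

text \<open>Substitute \<open>y = x + \<mu> * t + sqrt t * z\<close>. For positive times this moves
  the derivatives from \<open>F\<close> to the kernel.\<close>

lemma heat_mean_eq_gauss_moment:
  assumes t: "0 < t"
  shows "heat_mean F \<mu> t x = 1 / sqrt (2 * pi) * (t powr (-1/2) * gauss_moment F \<mu> 0 t x)"
proof -
  let ?f = "\<lambda>y. F y * exp (- (y - x - \<mu> * t)\<^sup>2 / (2 * t))"
  have "gauss_moment F \<mu> 0 t x = sqrt t * (\<integral>z. ?f ((x + \<mu> * t) + sqrt t * z) \<partial>lborel)"
    unfolding gauss_moment_def using lborel_integral_real_affine[of "sqrt t" ?f "x + \<mu> * t"] t by simp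
  also have "(\<lambda>z. ?f ((x + \<mu> * t) + sqrt t * z)) =
      (\<lambda>z. sqrt (2 * pi) * (F (x + \<mu> * t + sqrt t * z) * std_normal_density z))"
    using t by (auto simp: fun_eq_iff std_normal_density_def power_mult_distrib)
  also have "(\<integral>z. sqrt (2 * pi) * (F (x + \<mu> * t + sqrt t * z) * std_normal_density z) \<partial>lborel)
      = sqrt (2 * pi) * heat_mean F \<mu> t x"
    unfolding heat_mean_def by simp
  also have "t powr (-1/2) = 1 / sqrt t" using t by (simp add: powr_half_sqrt[symmetric] powr_minus_divide[symmetric])
  ultimately show ?thesis using t by simp
qed

lemma heat_mean_tendsto_0:
  assumes F: "exp_bounded F" and lim: "(F \<longlongrightarrow> 0) at_top" and t: "0 \<le> t"
  shows "((\<lambda>x. heat_mean F \<mu> t x) \<longlongrightarrow> 0) at_top"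
proof -
  note [measurable] = exp_bounded_measurable[OF F]
  obtain M where M: "0 \<le> M" "\<And>r x z. 0 \<le> r \<Longrightarrow> r \<le> t \<Longrightarrow> 0 \<le> x \<Longrightarrow>
    \<bar>F (x + \<mu> * r + sqrt r * z) * std_normal_density z\<bar> \<le> M * exp (- \<bar>z\<bar>)"
    by (rule heat_mean_bound[OF F t, of 0 \<mu>]) auto
  have "((\<lambda>x. \<integral>z. F (x + \<mu> * t + sqrt t * z) * std_normal_density z \<partial>lborel) \<longlongrightarrow> integral\<^sup>L lborel (\<lambda>z::real. 0)) at_top"
  proof (rule integral_dominated_convergence_at_top[where w="\<lambda>z. M * exp (- \<bar>z\<bar>)"])
    show "integrable lborel (\<lambda>z. M * exp (- \<bar>z\<bar>))" using integrable_exp_minus_abs by simp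
    have "((\<lambda>x. F (x + \<mu> * t + sqrt t * z) * std_normal_density z) \<longlongrightarrow> 0 * std_normal_density z) at_top" for z
    proof (intro tendsto_intros filterlim_compose[OF lim])
      show "filterlim (\<lambda>x. x + \<mu> * t + sqrt t * z) at_top at_top"
        using filterlim_tendsto_add_at_top[OF tendsto_const[of "\<mu> * t + sqrt t * z"] filterlim_ident]
        by (simp add: add_ac)
    qed
    then show "AE z in lborel. ((\<lambda>x. F (x + \<mu> * t + sqrt t * z) * std_normal_density z) \<longlongrightarrow> 0) at_top" by simp
    show "\<forall>\<^sub>F x in at_top. AE z in lborel. norm (F (x + \<mu> * t + sqrt t * z) * std_normal_density z) \<le> M * exp (- \<bar>z\<bar>)"
      using eventually_ge_at_top[of 0] by eventually_elim (use M t in auto)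
  qed auto
  then show ?thesis unfolding heat_mean_def by simp
qed

section \<open>Reflection at the boundary\<close>

lemma antiderivative_exists:
  fixes g :: "real \<Rightarrow> real"
  assumes "continuous_on UNIV g"
  obtains P where "P 0 = c" "\<And>y. (P has_real_derivative g y) (at y)"
proof -
  obtain P where P: "\<And>x::real. (P has_vector_derivative g x) (at x)"
    using einterval_antiderivative[of "-\<infinity>" \<infinity> g] assms by (auto simp: continuous_on_eq_continuous_at)
  have "((\<lambda>x. P x - P 0 + c) has_real_derivative g y) (at y)" for y
    using P[of y] unfolding has_real_derivative_iff_has_vector_derivative[symmetric]
    by (auto intro!: derivative_eq_intros)
  then show thesis using that[of "\<lambda>x. P x - P 0 + c"] by simp
qed

text \<open>The mean value inequality gives an extra factor \<open>\<bar>y\<bar>\<close>, which is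
  at most \<open>exp \<bar>y\<bar>\<close> and raises the rate by one.\<close>

lemma antiderivative_exp_bound:
  fixes P g :: "real \<Rightarrow> real"
  assumes P: "\<And>y. (P has_real_derivative g y) (at y)"
    and g: "\<And>y. \<bar>g y\<bar> \<le> C * exp (c * \<bar>y\<bar>)" and "0 \<le> C" "0 \<le> c"
  shows "\<bar>P y - P 0\<bar> \<le> C * exp ((c + 1) * \<bar>y\<bar>)"
proof -
  have "norm (P y - P 0) \<le> C * exp (c * \<bar>y\<bar>) * norm (y - 0)"
  proof (rule field_differentiable_bound[of "{-\<bar>y\<bar>..\<bar>y\<bar>}" _ g])
    fix z assume z: "z \<in> {-\<bar>y\<bar>..\<bar>y\<bar>}"
    show "(P has_real_derivative g z) (at z within {-\<bar>y\<bar>..\<bar>y\<bar>})"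
      by (rule has_field_derivative_at_within[OF P])
    have "c * \<bar>z\<bar> \<le> c * \<bar>y\<bar>" using z assms by (intro mult_left_mono) auto
    then have "C * exp (c * \<bar>z\<bar>) \<le> C * exp (c * \<bar>y\<bar>)" using assms by (intro mult_left_mono) auto
    with g[of z] show "norm (g z) \<le> C * exp (c * \<bar>y\<bar>)" by simp
  qed auto
  also have "C * exp (c * \<bar>y\<bar>) * norm (y - 0) \<le> C * exp (c * \<bar>y\<bar>) * exp \<bar>y\<bar>"
  proof (rule mult_left_mono)
    show "norm (y - 0) \<le> exp \<bar>y\<bar>"
      unfolding real_norm_def diff_0_right using exp_ge_add_one_self[of "\<bar>y\<bar>"] by linarith
  qed (use assms in auto)
  also have "\<dots> = C * exp ((c + 1) * \<bar>y\<bar>)"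
    by (simp add: exp_add[symmetric] algebra_simps)
  finally show ?thesis by simp
qed


text \<open>Split at 0 and reflect the negative half. The interval form of the result is suited to
  the fundamental theorem of calculus on the half line.\<close>

lemma lborel_integral_fold:
  fixes g :: "real \<Rightarrow> real"
  assumes g: "integrable lborel g"
  shows "(\<integral>y. g y \<partial>lborel) = (LBINT y=0..\<infinity>. g y + g (- y))"
    "set_integrable lborel {0<..} (\<lambda>y. g y + g (- y))"
proof -
  have i1: "integrable lborel (\<lambda>y. indicator {0<..} y * g y)"
    using g integrable_real_mult_indicator[of "{0<..}" lborel g] by (simp add: mult.commute)
  have i2: "integrable lborel (\<lambda>y. indicator {..<0} y * g y)"
    using g integrable_real_mult_indicator[of "{..<0}" lborel g] by (simp add: mult.commute)
  have eq: "indicator {..<0} (- y) = (indicator {0<..} y :: real)" for y :: real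
    by (simp add: indicator_def)
  have i3: "integrable lborel (\<lambda>y. indicator {0<..} y * g (- y))"
    using lborel_integrable_real_affine[OF i2, of "-1" 0] by (simp add: eq)
  show "set_integrable lborel {0<..} (\<lambda>y. g y + g (- y))"
    unfolding set_integrable_def using Bochner_Integration.integrable_add[OF i1 i3]
    by (simp add: algebra_simps)
  have "(\<integral>y. g y \<partial>lborel) = (\<integral>y. indicator {0<..} y * g y + indicator {..<0} y * g y \<partial>lborel)"
  proof (rule integral_cong_AE)
    show "AE y in lborel. g y = indicator {0<..} y * g y + indicator {..<0} y * g y"
      using AE_lborel_singleton[of 0] by eventually_elim (auto simp: indicator_def)
  qed (use g i1 i2 in auto)
  also have "\<dots> = (\<integral>y. indicator {0<..} y * g y \<partial>lborel) + (\<integral>y. indicator {..<0} y * g y \<partial>lborel)"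
    using i1 i2 by simp
  also have "(\<integral>y. indicator {..<0} y * g y \<partial>lborel) = (\<integral>y. indicator {0<..} y * g (- y) \<partial>lborel)"
    using lborel_integral_real_affine[of "-1" "\<lambda>y. indicator {..<0} y * g y" 0] by (simp add: eq)
  also have "(\<integral>y. indicator {0<..} y * g y \<partial>lborel) + (\<integral>y. indicator {0<..} y * g (- y) \<partial>lborel)
     = (\<integral>y. indicator {0<..} y * (g y + g (- y)) \<partial>lborel)"
    using i1 i3 by (simp add: distrib_left)
  finally show "(\<integral>y. g y \<partial>lborel) = (LBINT y=0..\<infinity>. g y + g (- y))"
    using interval_integral_to_infinity_eq[of lborel 0 "\<lambda>y. g y + g (- y)"]
    by (simp add: set_lebesgue_integral_def zero_ereal_def)
qed

text \<open>After folding the integral at \<open>0\<close>, the ODE for \<open>K\<close> makes the integrand the derivative of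
  \<open>K y * exp (- (y + \<mu> t)\<^sup>2 / (2 t))\<close>.\<close>

lemma reflected_boundary_condition:
  fixes h K G :: "real \<Rightarrow> real"
  assumes G: "exp_bounded G"
    and G_pos: "\<And>y. 0 < y \<Longrightarrow> G y = h y"
    and G_neg: "\<And>y. 0 < y \<Longrightarrow> G (- y) = exp (2 * \<mu> * y) * h y + K y"
    and K0: "K 0 = 0"
    and K: "\<And>y. (K has_real_derivative a * K y + 2 * (a - \<mu>) * exp (2 * \<mu> * y) * h y) (at y)"
    and K_bound: "\<And>y. 0 \<le> y \<Longrightarrow> \<bar>K y\<bar> \<le> C * exp (c * y)" "0 \<le> c"
    and t: "0 < t"
  shows "gauss_moment G \<mu> 1 t 0 / t + a * gauss_moment G \<mu> 0 t 0 = 0"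
proof -
  define g where "g y = G y * (((y - \<mu> * t) / t + a) * exp (- (y - \<mu> * t)\<^sup>2 / (2 * t)))" for y
  have Gc: "continuous_on UNIV G" using G unfolding exp_bounded_def by blast
  have gc: "isCont g y" for y
  proof -
    have "isCont G y" using Gc by (simp add: continuous_on_eq_continuous_at)
    then show ?thesis unfolding g_def using t by (intro continuous_intros) auto
  qed
  note int = integrable_gauss_integrand[OF G t, of 0 \<mu>, unfolded diff_0_right]
  have g_eq: "g = (\<lambda>y. G y * ((y - \<mu> * t) ^ 1 * exp (- (y - \<mu> * t)\<^sup>2 / (2 * t))) / t
      + a * (G y * ((y - \<mu> * t) ^ 0 * exp (- (y - \<mu> * t)\<^sup>2 / (2 * t)))))"
    unfolding g_def by (auto simp: fun_eq_iff field_simps)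
  have gi: "integrable lborel g"
    unfolding g_eq by (intro Bochner_Integration.integrable_add integrable_mult_right integrable_divide int)
  have "gauss_moment G \<mu> 1 t 0 / t + a * gauss_moment G \<mu> 0 t 0 = (\<integral>y. g y \<partial>lborel)"
    unfolding gauss_moment_def g_eq using int[of 0] int[of 1] by simp
  also have "\<dots> = (LBINT y=0..\<infinity>. g y + g (- y))"
    by (rule lborel_integral_fold[OF gi])
  \<comment> \<open>Both boundary values of the antiderivative \<open>D\<close> vanish: at 0 because
    \<open>K 0 = 0\<close>, at infinity because the Gaussian beats the exponential growth of
    \<open>K\<close>.\<close>
  also have "\<dots> = 0 - 0"
  proof (rule interval_integral_FTC_integrable)
    define D where "D y = K y * exp (- (y + \<mu> * t)\<^sup>2 / (2 * t))" for y
    have D_deriv: "(D has_real_derivative g y + g (- y)) (at y)" if y: "0 < y" for y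
    proof -
      define e where "e = exp (- (y + \<mu> * t)\<^sup>2 / (2 * t))"
      define E where "E = exp (2 * \<mu> * y)"
      \<comment> \<open>The quotient of the kernels at \<open>y\<close> and \<open>- y\<close> is
        \<open>exp (2 * \<mu> * y)\<close>, which is the factor in the reflection rule
        \<open>G_neg\<close>.\<close>
      have "- (y - \<mu> * t)\<^sup>2 / (2 * t) = 2 * \<mu> * y + - (y + \<mu> * t)\<^sup>2 / (2 * t)"
        using t by (simp add: field_simps power2_eq_square)
      then have k: "exp (- (y - \<mu> * t)\<^sup>2 / (2 * t)) = E * e"
        unfolding e_def E_def exp_add[symmetric] by (rule arg_cong)
      have "(- y - \<mu> * t)\<^sup>2 = (y + \<mu> * t)\<^sup>2" by (simp add: power2_eq_square algebra_simps)
      then have "g (- y) = (E * h y + K y) * (((- y - \<mu> * t) / t + a) * e)"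
        unfolding g_def G_neg[OF y] e_def E_def by simp
      moreover have "g y = h y * (((y - \<mu> * t) / t + a) * (E * e))"
        unfolding g_def G_pos[OF y] k by simp
      \<comment> \<open>In the coefficient of \<open>h y\<close> the terms \<open>y / t\<close>
        cancel and \<open>2 * (a - \<mu>)\<close> remains, which is the inhomogeneity of the ODE for
        \<open>K\<close>.\<close>
      ultimately have "g y + g (- y) =
          (a * K y + 2 * (a - \<mu>) * E * h y) * e + K y * (e * (- (y + \<mu> * t) / t))"
        using t by (simp add: field_simps)
      moreover have "(D has_real_derivative
          (a * K y + 2 * (a - \<mu>) * E * h y) * e + K y * (e * (- (y + \<mu> * t) / t))) (at y)"
        unfolding D_def e_def E_def using t
        by (auto intro!: derivative_eq_intros K simp: field_simps power2_eq_square)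
      ultimately show ?thesis by simp
    qed
    then show "(D has_vector_derivative g y + g (- y)) (at y)" if "0 < ereal y" for y
      using that by (simp add: has_real_derivative_iff_has_vector_derivative zero_ereal_def)
    have "isCont D 0" unfolding D_def using DERIV_isCont[OF K] t by (intro continuous_intros) auto
    then have "(D \<longlongrightarrow> D 0) (at_right 0)" unfolding isCont_def by (rule tendsto_within_subset) simp
    then have "(D \<longlongrightarrow> 0) (at_right 0)" by (simp add: D_def K0)
    then show "((D \<circ> real_of_ereal) \<longlongrightarrow> 0) (at_right 0)"
      by (simp add: zero_ereal_def ereal_tendsto_simps)
    \<comment> \<open>The Gaussian is traded for decay of rate \<open>c + 1\<close>; the growth of
      \<open>K\<close> takes \<open>c\<close> of it and \<open>exp (- y)\<close> is left.\<close>
    define M where "M = C * (exp (t * (c + 2)\<^sup>2 / 2) * exp ((c + 1) * (\<bar>\<mu>\<bar> * t)))"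
    have D_bound: "norm (D y) \<le> M * exp (- y)" if y: "0 \<le> y" for y
    proof -
      have "0 \<le> C" using K_bound(1)[of 0] by simp
      have "y - \<bar>\<mu>\<bar> * t \<le> \<bar>y + \<mu> * t\<bar>" using y t abs_mult[of \<mu> t] by linarith
      then have "(c + 1) * (y - \<bar>\<mu>\<bar> * t) \<le> (c + 1) * \<bar>y + \<mu> * t\<bar>"
        using K_bound(2) by (intro mult_left_mono) auto
      then have "- ((c + 1) * \<bar>y + \<mu> * t\<bar>) \<le> (c + 1) * (\<bar>\<mu>\<bar> * t) - (c + 1) * y"
        by (simp add: algebra_simps)
      then have "exp (- ((c + 1) * \<bar>y + \<mu> * t\<bar>)) \<le> exp ((c + 1) * (\<bar>\<mu>\<bar> * t) - (c + 1) * y)" by simp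
      then have "exp (t * (c + 2)\<^sup>2 / 2) * exp (- ((c + 1) * \<bar>y + \<mu> * t\<bar>))
          \<le> exp (t * (c + 2)\<^sup>2 / 2) * exp ((c + 1) * (\<bar>\<mu>\<bar> * t) - (c + 1) * y)"
        by (intro mult_left_mono) auto
      moreover have "exp (- (y + \<mu> * t)\<^sup>2 / (2 * t)) \<le> exp (t * (c + 2)\<^sup>2 / 2) * exp (- ((c + 1) * \<bar>y + \<mu> * t\<bar>))"
        using abs_power_mult_exp_le[of t t c "y + \<mu> * t" 0] t K_bound(2) by simp
      ultimately have e: "exp (- (y + \<mu> * t)\<^sup>2 / (2 * t)) \<le> exp (t * (c + 2)\<^sup>2 / 2) * exp ((c + 1) * (\<bar>\<mu>\<bar> * t) - (c + 1) * y)"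
        by linarith
      have "norm (D y) = \<bar>K y\<bar> * exp (- (y + \<mu> * t)\<^sup>2 / (2 * t))" unfolding D_def by (simp add: abs_mult)
      also have "\<dots> \<le> (C * exp (c * y)) * (exp (t * (c + 2)\<^sup>2 / 2) * exp ((c + 1) * (\<bar>\<mu>\<bar> * t) - (c + 1) * y))"
        using y \<open>0 \<le> C\<close> by (intro mult_mono K_bound e) auto
      also have "\<dots> = C * (exp (t * (c + 2)\<^sup>2 / 2) * (exp (c * y) * exp ((c + 1) * (\<bar>\<mu>\<bar> * t) - (c + 1) * y)))"
        by (simp add: mult_ac)
      also have "exp (c * y) * exp ((c + 1) * (\<bar>\<mu>\<bar> * t) - (c + 1) * y) = exp ((c + 1) * (\<bar>\<mu>\<bar> * t)) * exp (- y)"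
        by (simp add: exp_add[symmetric] algebra_simps)
      finally show ?thesis unfolding M_def by (simp add: mult_ac)
    qed
    have "(D \<longlongrightarrow> 0) at_top"
    proof (rule Lim_null_comparison)
      show "\<forall>\<^sub>F y in at_top. norm (D y) \<le> M * exp (- y)"
        using eventually_ge_at_top[of 0] by eventually_elim (rule D_bound)
      have "((\<lambda>y. exp (- y)) \<longlongrightarrow> (0::real)) at_top"
        by (rule filterlim_compose[OF exp_at_bot filterlim_uminus_at_bot_at_top])
      then show "((\<lambda>y. M * exp (- y)) \<longlongrightarrow> 0) at_top"
        using tendsto_mult_left[of _ 0 _ M] by simp
    qed
    then show "((D \<circ> real_of_ereal) \<longlongrightarrow> 0) (at_left \<infinity>)"
      by (simp add: ereal_tendsto_simps)
    show "set_integrable lborel (einterval 0 \<infinity>) (\<lambda>y. g y + g (- y))"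
      using lborel_integral_fold(2)[OF gi] by (simp add: zero_ereal_def)
    show "isCont (\<lambda>y. g y + g (- y)) y" for y
      by (intro continuous_intros gc isCont_o2[OF _ gc])
  qed simp
  finally show ?thesis by simp
qed

text \<open>The linear ODE for \<open>K\<close> is solved explicitly, \<open>G\<close> is assembled
  from \<open>f'\<close> and \<open>K\<close>, and \<open>F\<close> is the antiderivative of
  \<open>G\<close> with \<open>F 0 = f 0\<close>. Only the continuous function \<open>f'\<close> is
  integrated, so no second derivative of \<open>f\<close> appears.\<close>

lemma reflected_extension_exists:
  fixes f :: "real \<Rightarrow> real"
  assumes f: "Cb1_halfline f" and lim: "(f \<longlongrightarrow> 0) at_top"
  obtains F G where "exp_bounded F" "exp_bounded G" "\<And>y. (F has_real_derivative G y) (at y)"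
    "\<And>x. 0 \<le> x \<Longrightarrow> F x = f x" "(F \<longlongrightarrow> 0) at_top"
    "\<And>t. 0 < t \<Longrightarrow> gauss_moment G \<mu> 1 t 0 / t + a * gauss_moment G \<mu> 0 t 0 = 0"
proof -
  from f obtain f' B0 B where f': "\<And>x. 0 \<le> x \<Longrightarrow> (f has_real_derivative f' x) (at x within {0..})"
    "continuous_on {0..} f'"
    and B0: "\<And>x. 0 \<le> x \<Longrightarrow> \<bar>f x\<bar> \<le> B0" and B: "\<And>x. 0 \<le> x \<Longrightarrow> \<bar>f' x\<bar> \<le> B"
    unfolding Cb1_halfline_def bounded_iff by (metis (no_types, lifting) atLeast_iff image_eqI real_norm_def)
  have B_nonneg: "0 \<le> B0" "0 \<le> B" using B0[of 0] B[of 0] by auto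
  \<comment> \<open>The even extension of \<open>f'\<close> is continuous and bounded on the whole
    line, so the ODE for \<open>K\<close> can be solved there.\<close>
  define h where "h x = f' \<bar>x\<bar>" for x
  have h: "continuous_on UNIV h" "\<And>x. \<bar>h x\<bar> \<le> B"
    unfolding h_def by (auto intro!: continuous_on_compose2[OF f'(2)] continuous_intros B)
  define q where "q = \<bar>2 * \<mu> - a\<bar>"
  obtain P where P: "P 0 = 0" "\<And>y. (P has_real_derivative exp ((2 * \<mu> - a) * y) * h y) (at y)"
    by (rule antiderivative_exists[of "\<lambda>y. exp ((2 * \<mu> - a) * y) * h y" 0])
       (intro continuous_intros h, blast)
  have "\<bar>exp ((2 * \<mu> - a) * y) * h y\<bar> \<le> B * exp (q * \<bar>y\<bar>)" for y
  proof -
    have "(2 * \<mu> - a) * y \<le> q * \<bar>y\<bar>" unfolding q_def abs_mult[symmetric] by (rule abs_ge_self)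
    then have "exp ((2 * \<mu> - a) * y) * \<bar>h y\<bar> \<le> exp (q * \<bar>y\<bar>) * B" by (intro mult_mono h) auto
    then show ?thesis by (simp add: abs_mult mult.commute)
  qed
  then have P_bound: "\<bar>P y\<bar> \<le> B * exp ((q + 1) * \<bar>y\<bar>)" for y
    using antiderivative_exp_bound[OF P(2), of B q y] P(1) B_nonneg unfolding q_def by simp
  \<comment> \<open>Variation of constants: \<open>exp (a * y)\<close> solves the homogeneous
    equation, and \<open>P\<close> integrates the inhomogeneity divided by it.\<close>
  define K where "K y = 2 * (a - \<mu>) * (exp (a * y) * P y)" for y
  have K: "(K has_real_derivative a * K y + 2 * (a - \<mu>) * exp (2 * \<mu> * y) * h y) (at y)" for y
  proof -
    have "exp (a * y) * exp ((2 * \<mu> - a) * y) = exp (2 * \<mu> * y)"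
      by (simp add: exp_add[symmetric] algebra_simps)
    then have "a * K y + 2 * (a - \<mu>) * exp (2 * \<mu> * y) * h y =
        2 * (a - \<mu>) * (exp (a * y) * a * P y + exp (a * y) * (exp ((2 * \<mu> - a) * y) * h y))"
      unfolding K_def by (simp add: algebra_simps)
    then show ?thesis
      unfolding K_def by (auto intro!: derivative_eq_intros P(2) simp: algebra_simps)
  qed
  \<comment> \<open>Large enough for both growth rates in \<open>G\<close>: \<open>a + q + 1\<close>
    from \<open>K\<close> and \<open>2 * \<mu>\<close> from the reflection factor.\<close>
  define c where "c = \<bar>a\<bar> + q + 1 + 2 * \<bar>\<mu>\<bar>"
  define C where "C = 2 * \<bar>a - \<mu>\<bar> * B"
  have C: "0 \<le> C" "0 \<le> c" using B_nonneg unfolding C_def c_def q_def by auto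
  have K_bound: "\<bar>K y\<bar> \<le> C * exp (c * y)" if y: "0 \<le> y" for y
  proof -
    have "a * y + (q + 1) * y \<le> c * y"
      unfolding c_def distrib_right[symmetric] using y by (intro mult_right_mono) auto
    then have e: "exp (a * y + (q + 1) * y) \<le> exp (c * y)" by simp
    have "\<bar>K y\<bar> = 2 * \<bar>a - \<mu>\<bar> * (exp (a * y) * \<bar>P y\<bar>)" unfolding K_def abs_mult by simp
    also have "\<dots> \<le> 2 * \<bar>a - \<mu>\<bar> * (exp (a * y) * (B * exp ((q + 1) * y)))"
      using P_bound[of y] y by (intro mult_left_mono) auto
    also have "\<dots> = C * exp (a * y + (q + 1) * y)" unfolding C_def by (simp add: exp_add)
    also have "\<dots> \<le> C * exp (c * y)" using e C by (intro mult_left_mono) auto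
    finally show ?thesis .
  qed
  \<comment> \<open>The cut-off \<open>max (- x) 0\<close> joins both branches in one continuous
    formula: for \<open>0 \<le> x\<close> it reduces to \<open>f' x\<close> because
    \<open>K 0 = 0\<close>, and for negative \<open>x\<close> it is the reflected branch because
    \<open>h\<close> is even.\<close>
  define G where "G x = exp (2 * \<mu> * max (- x) 0) * h x + K (max (- x) 0)" for x
  have Kc: "continuous_on UNIV K"
    using DERIV_isCont[OF K] by (simp add: continuous_on_eq_continuous_at)
  have G_bound: "\<bar>G y\<bar> \<le> (B + C) * exp (c * max (- y) 0)" for y
  proof -
    define m where "m = max (- y) 0"
    have m: "0 \<le> m" unfolding m_def by simp
    have "2 * \<mu> * m \<le> c * m" using m unfolding c_def q_def by (intro mult_right_mono) auto
    then have "exp (2 * \<mu> * m) * \<bar>h y\<bar> \<le> exp (c * m) * B" by (intro mult_mono h) auto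
    then have "\<bar>exp (2 * \<mu> * m) * h y\<bar> \<le> B * exp (c * m)" by (simp add: abs_mult mult.commute)
    with K_bound[OF m] show ?thesis
      unfolding G_def m_def[symmetric] distrib_right by linarith
  qed
  have e: "exp (c * max (- y) 0) \<le> 1 + exp (- (c * y))" for y
    by (auto simp: max_def)
  have G: "exp_bounded G"
    unfolding exp_bounded_def
  proof (intro conjI exI allI)
    show "continuous_on UNIV G"
      unfolding G_def by (intro continuous_intros h continuous_on_compose2[OF Kc]) auto
    show "\<bar>G y\<bar> \<le> (B + C) * (1 + exp (- (c * y)))" for y
      using C B_nonneg by (intro order_trans[OF G_bound] mult_left_mono e) auto
  qed (use C B_nonneg in auto)
  obtain F where F: "F 0 = f 0" "\<And>y. (F has_real_derivative G y) (at y)"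
    using antiderivative_exists[of G "f 0"] G unfolding exp_bounded_def by blast
  have Ff: "F x = f x" if "0 \<le> x" for x
  proof -
    have "((\<lambda>x. F x - f x) has_real_derivative 0) (at x within {0..})" if "x \<in> {0..}" for x
    proof -
      have "G x = f' x" using that by (simp add: G_def h_def max_def K_def P(1))
      then show ?thesis
        using DERIV_diff[OF has_field_derivative_at_within[OF F(2)[of x]] f'(1)[of x]] that by simp
    qed
    then obtain d where "\<And>x. 0 \<le> x \<Longrightarrow> F x - f x = d"
      using has_field_derivative_zero_constant[of "{0..}" "\<lambda>x. F x - f x"] by auto
    from this[of 0] this[OF that] F(1) show ?thesis by simp
  qed
  have F_exp: "exp_bounded F"
    unfolding exp_bounded_def
  proof (intro conjI exI allI)
    show "continuous_on UNIV F"
      using DERIV_isCont[OF F(2)] by (simp add: continuous_on_eq_continuous_at)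
    \<comment> \<open>\<open>B0\<close> covers \<open>f\<close> on the right and the value
      \<open>f 0\<close> on the left; \<open>B + C\<close> comes from the bound on \<open>G\<close>,
      whose integration raises the rate to \<open>c + 1\<close>.\<close>
    let ?C = "B0 + (B + C)"
    show "\<bar>F y\<bar> \<le> ?C * (1 + exp (- ((c + 1) * y)))" for y
    proof (cases "0 \<le> y")
      case True
      then have "\<bar>F y\<bar> \<le> B0" using Ff B0 by simp
      also have "\<dots> \<le> ?C * 1" using C B_nonneg by simp
      also have "\<dots> \<le> ?C * (1 + exp (- ((c + 1) * y)))" using C B_nonneg by (intro mult_left_mono) auto
      finally show ?thesis .
    next
      case False
      have "exp (c * max (- y) 0) \<le> exp (c * \<bar>y\<bar>)" for y using C by (auto intro!: mult_left_mono)
      then have "\<bar>G y\<bar> \<le> (B + C) * exp (c * \<bar>y\<bar>)" for y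
        using C B_nonneg by (intro order_trans[OF G_bound] mult_left_mono) auto
      from antiderivative_exp_bound[OF F(2) this, of y] C B_nonneg
      have "\<bar>F y\<bar> \<le> \<bar>f 0\<bar> + (B + C) * exp ((c + 1) * \<bar>y\<bar>)" using F(1) by simp
      also have "\<dots> \<le> ?C * 1 + ?C * exp (- ((c + 1) * y))"
      proof (rule add_mono)
        show "\<bar>f 0\<bar> \<le> ?C * 1" using B0[of 0] C B_nonneg by simp
        show "(B + C) * exp ((c + 1) * \<bar>y\<bar>) \<le> ?C * exp (- ((c + 1) * y))"
          using False C B_nonneg by (intro mult_mono) auto
      qed
      finally show ?thesis by (simp add: distrib_left)
    qed
  qed (use C B_nonneg in auto)
  show thesis
  proof (rule that[OF F_exp G F(2) Ff])
    show "(F \<longlongrightarrow> 0) at_top"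
      by (rule Lim_transform_eventually[OF lim])
         (use eventually_ge_at_top[of 0] in eventually_elim, simp add: Ff)
    show "gauss_moment G \<mu> 1 t 0 / t + a * gauss_moment G \<mu> 0 t 0 = 0" if "0 < t" for t
    proof (rule reflected_boundary_condition[OF G _ _ _ K K_bound C(2) that])
      show "G (- y) = exp (2 * \<mu> * y) * h y + K y" if "0 < y" for y
        using that by (simp add: G_def h_def max_def)
      show "G y = h y" if "0 < y" for y using that by (simp add: G_def max_def K_def P(1))
    qed (simp_all add: K_def P(1))
  qed auto
qed

section \<open>Existence\<close>

text \<open>The solution is \<open>heat_mean F \<mu>\<close> with gradient
  \<open>heat_mean G \<mu>\<close>. Its second derivative is written in two ways: moments of
  \<open>F\<close> yield the differential equation, moments of \<open>G\<close> yield the boundary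
  condition.\<close>

lemma solution_exists:
  fixes \<mu> \<nu> :: real
  assumes "Cb1_halfline f" "(f \<longlongrightarrow> 0) at_top"
  shows "\<exists>u. is_solution \<mu> \<nu> f u"
proof -
  obtain F G where F: "exp_bounded F" and G: "exp_bounded G"
    and FG: "\<And>y. (F has_real_derivative G y) (at y)"
    and Ff: "\<And>x. 0 \<le> x \<Longrightarrow> F x = f x" and lim: "(F \<longlongrightarrow> 0) at_top"
    and bc: "\<And>t. 0 < t \<Longrightarrow> gauss_moment G \<mu> 1 t 0 / t + 2 * (\<mu> - \<nu>) * gauss_moment G \<mu> 0 t 0 = 0"
    using reflected_extension_exists[OF assms, of \<mu> "2 * (\<mu> - \<nu>)"] by metis
  define \<kappa> where "\<kappa> = 1 / sqrt (2 * pi)"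
  note eqF = heat_mean_eq_gauss_moment[of _ F \<mu>, folded \<kappa>_def]
  note eqG = heat_mean_eq_gauss_moment[of _ G \<mu>, folded \<kappa>_def]
  let ?I = "gauss_moment F \<mu>"
  have ux: "heat_mean G \<mu> t x = \<kappa> * (t powr (-1/2) * (?I 1 t x / t))" if t: "0 < t" for t x
  proof (rule DERIV_unique)
    show "((\<lambda>x. heat_mean F \<mu> t x) has_real_derivative heat_mean G \<mu> t x) (at x)"
      using t by (intro heat_mean_deriv_x F G FG) auto
    show "((\<lambda>x. heat_mean F \<mu> t x) has_real_derivative \<kappa> * (t powr (-1/2) * (?I 1 t x / t))) (at x)"
      unfolding eqF[OF t] using gauss_moment_deriv_x[OF F t, of \<mu> 0 x]
      by (intro DERIV_cmult) simp
  qed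
  define uxx where "uxx t x = \<kappa> * (t powr (-1/2) * ((?I 2 t x / t - ?I 0 t x) / t))" for t x
  have uxx: "((\<lambda>x. heat_mean G \<mu> t x) has_real_derivative uxx t x) (at x)" if t: "0 < t" for t x
    unfolding uxx_def ux[OF t] using gauss_moment_deriv_x[OF F t, of \<mu> 1 x]
    by (intro DERIV_cmult DERIV_cdivide) (simp add: numeral_2_eq_2)
  \<comment> \<open>Differentiating the heat mean of \<open>G\<close> through the kernel produces
    the first moment of \<open>G\<close>, to which the reflection identity \<open>bc\<close>
    applies.\<close>
  have uxx_G: "uxx t x = \<kappa> * (t powr (-1/2) * (gauss_moment G \<mu> 1 t x / t))" if t: "0 < t" for t x
  proof (rule DERIV_unique[OF uxx[OF t]])
    show "((\<lambda>x. heat_mean G \<mu> t x) has_real_derivative \<kappa> * (t powr (-1/2) * (gauss_moment G \<mu> 1 t x / t))) (at x)"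
      unfolding eqG[OF t] using gauss_moment_deriv_x[OF G t, of \<mu> 0 x]
      by (intro DERIV_cmult) simp
  qed
  have ut: "((\<lambda>t. heat_mean F \<mu> t x) has_real_derivative \<mu> * heat_mean G \<mu> t x + uxx t x / 2) (at t)"
    if t: "0 < t" for t x
  proof -
    have "((\<lambda>t. \<kappa> * (t powr (-1/2) * ?I 0 t x)) has_real_derivative
        \<kappa> * ((-1/2) * t powr (-1/2 - 1) * ?I 0 t x
          + (\<mu> * ?I 1 t x / t + ?I 2 t x / (2 * t\<^sup>2)) * t powr (-1/2))) (at t)"
      using gauss_moment_deriv_t[OF F t, of \<mu> 0 x]
      by (intro DERIV_cmult DERIV_mult has_real_derivative_powr t) (simp add: numeral_2_eq_2)
    also have "\<kappa> * ((-1/2) * t powr (-1/2 - 1) * ?I 0 t x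
          + (\<mu> * ?I 1 t x / t + ?I 2 t x / (2 * t\<^sup>2)) * t powr (-1/2))
        = \<mu> * heat_mean G \<mu> t x + uxx t x / 2"
      unfolding ux[OF t] uxx_def powr_diff using t by (simp add: field_simps power2_eq_square)
    finally show ?thesis
      \<comment> \<open>Within distance \<open>t\<close> of \<open>t\<close> all times are positive,
        so the moment formula holds there.\<close>
      by (rule has_field_derivative_transform_within[of _ _ _ _ t]) (use t eqF in \<open>auto simp: dist_real_def\<close>)
  qed
  have bc': "uxx t 0 / 2 = (\<nu> - \<mu>) * heat_mean G \<mu> t 0" if t: "0 < t" for t
  proof -
    have "gauss_moment G \<mu> 1 t 0 / t = 2 * (\<nu> - \<mu>) * gauss_moment G \<mu> 0 t 0"
      using bc[OF t] by (simp add: algebra_simps)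
    then show ?thesis unfolding uxx_G[OF t] eqG[OF t] by simp
  qed
  have "smooth2_on ({0<..} \<times> {0..}) (heat_mean F \<mu>)"
  proof (rule smooth2_on_half_strip_if[where P="gauss_span F \<mu>"])
    show "gauss_span F \<mu> (\<lambda>t x. \<kappa> * (t powr (-1/2) * ?I 0 t x))"
      by (intro gauss_span.intros)
    show "continuous_on ({0<..} \<times> {0..}) (\<lambda>(t, x). g t x)" if "gauss_span F \<mu> g" for g
      by (rule continuous_on_subset[OF gauss_span_continuous[OF F that]]) auto
    show "\<exists>h. gauss_span F \<mu> h \<and> (\<forall>t x. (t, x) \<in> {0<..} \<times> {0..} \<longrightarrow>
        ((\<lambda>s. g s x) has_real_derivative h t x) (at t))" if "gauss_span F \<mu> g" for g
      using gauss_span_deriv_t[OF F that] by auto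
    show "\<exists>h. gauss_span F \<mu> h \<and> (\<forall>t x. (t, x) \<in> {0<..} \<times> {0..} \<longrightarrow>
        ((\<lambda>y. g t y) has_real_derivative h t x) (at x))" if "gauss_span F \<mu> g" for g
      using gauss_span_deriv_x[OF F that] by auto
  qed (use eqF in auto)
  moreover have "\<forall>t\<ge>0. \<forall>x\<ge>0. ((\<lambda>y. heat_mean F \<mu> t y) has_real_derivative heat_mean G \<mu> t x) (at x within {0..})"
    using heat_mean_deriv_x[OF F G FG] by (blast intro: has_field_derivative_at_within)
  moreover have "\<forall>T>0. Cb2_on ({0..T} \<times> {0..}) (heat_mean F \<mu>) \<and> Cb2_on ({0..T} \<times> {0..}) (heat_mean G \<mu>)"
    by (simp add: Cb2_on_heat_mean F G)
  moreover have "\<forall>t>0. \<forall>x\<ge>0. \<exists>uxx. ((\<lambda>y. heat_mean G \<mu> t y) has_real_derivative uxx) (at x within {0..})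
      \<and> ((\<lambda>s. heat_mean F \<mu> s x) has_real_derivative (\<mu> * heat_mean G \<mu> t x + uxx / 2)) (at t)"
    using uxx ut by (blast intro: has_field_derivative_at_within)
  moreover have "\<forall>t>0. ((\<lambda>s. heat_mean F \<mu> s 0) has_real_derivative (\<nu> * heat_mean G \<mu> t 0)) (at t)"
  proof (intro allI impI)
    fix t :: real assume t: "0 < t"
    have "\<mu> * heat_mean G \<mu> t 0 + uxx t 0 / 2 = \<nu> * heat_mean G \<mu> t 0"
      unfolding bc'[OF t] by (simp add: algebra_simps)
    with ut[OF t, of 0] show "((\<lambda>s. heat_mean F \<mu> s 0) has_real_derivative (\<nu> * heat_mean G \<mu> t 0)) (at t)" by simp
  qed
  moreover have "\<forall>t>0. ((\<lambda>x. heat_mean F \<mu> t x) \<longlongrightarrow> 0) at_top"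
    using heat_mean_tendsto_0[OF F lim] by simp
  moreover have "\<forall>x\<ge>0. heat_mean F \<mu> 0 x = f x" using Ff by simp
  ultimately have "is_solution \<mu> \<nu> f (heat_mean F \<mu>)"
    unfolding is_solution_def by blast
  then show ?thesis by blast
qed

section \<open>Uniqueness\<close>

text \<open>A positive \<open>D\<close> would make \<open>f'\<close> positive just to the right of
  the critical point \<open>x0\<close>, and the mean value theorem would give a larger value of
  \<open>f\<close> there.\<close>

lemma second_derivative_nonpos_at_max:
  fixes f f' :: "real \<Rightarrow> real"
  assumes f: "\<And>x. a < x \<Longrightarrow> (f has_real_derivative f' x) (at x)"
    and D: "(f' has_real_derivative D) (at x0)" and "a < x0"
    and max: "\<And>x. a < x \<Longrightarrow> f x \<le> f x0"
  shows "f' x0 = 0" "D \<le> 0"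
proof -
  show f'0: "f' x0 = 0"
    by (rule DERIV_local_max[OF f[OF \<open>a < x0\<close>], of "x0 - a"]) (use \<open>a < x0\<close> max in auto)
  show "D \<le> 0"
  proof (rule ccontr)
    assume "\<not> D \<le> 0"
    then obtain d where d: "d > 0" "\<And>h. 0 < h \<Longrightarrow> h < d \<Longrightarrow> f' x0 < f' (x0 + h)"
      using DERIV_pos_inc_right[OF D] by (metis not_le)
    obtain z where z: "x0 < z" "z < x0 + d / 2" "f (x0 + d / 2) - f x0 = (x0 + d / 2 - x0) * f' z"
      using MVT2[of x0 "x0 + d / 2" f f'] f d(1) \<open>a < x0\<close> by auto
    have "0 < f' z" using d(2)[of "z - x0"] z f'0 d(1) by simp
    then have "f x0 < f (x0 + d / 2)" using z(3) d(1) by (smt (verit) mult_pos_pos half_gt_zero)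
    with max[of "x0 + d / 2"] \<open>a < x0\<close> d(1) show False by simp
  qed
qed

text \<open>If \<open>w\<close> is positive somewhere, its quotient by the growing function
  \<open>z\<close> has a positive maximum \<open>m\<close>. At the maximum point \<open>w\<close>
  touches \<open>m * z\<close> from below. This contradicts \<open>init\<close> at the initial time,
  the strict Robin inequality at the boundary and the strict differential inequality in the
  interior. The sign of \<open>\<gamma>\<close> is arbitrary.\<close>

lemma robin_max_principle:
  fixes w wx wxx :: "real \<Rightarrow> real \<Rightarrow> real"
  assumes cont: "continuous_on ({0..T} \<times> {0..}) (\<lambda>(t, x). w t x)"
    and bound: "\<And>t x. 0 \<le> t \<Longrightarrow> t \<le> T \<Longrightarrow> 0 \<le> x \<Longrightarrow> w t x \<le> M"
    and wx: "\<And>t x. 0 < t \<Longrightarrow> 0 \<le> x \<Longrightarrow> ((\<lambda>y. w t y) has_real_derivative wx t x) (at x within {0..})"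
    and wxx: "\<And>t x. 0 < t \<Longrightarrow> 0 < x \<Longrightarrow> ((\<lambda>y. wx t y) has_real_derivative wxx t x) (at x)"
    and wt: "\<And>t x. 0 < t \<Longrightarrow> 0 < x \<Longrightarrow> ((\<lambda>s. w s x) has_real_derivative \<mu> * wx t x + wxx t x / 2) (at t)"
    and robin: "\<And>t. 0 < t \<Longrightarrow> wx t 0 = \<gamma> * w t 0"
    and init: "\<And>x. 0 \<le> x \<Longrightarrow> w 0 x \<le> 0"
    and t1: "0 \<le> t1" "t1 \<le> T" and x1: "0 \<le> x1"
  shows "w t1 x1 \<le> 0"
proof (rule ccontr)
  assume "\<not> w t1 x1 \<le> 0"
  then have pos: "0 < w t1 x1" by simp
  define b where "b = 2 + 2 * \<bar>\<gamma>\<bar>"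
  define \<Lambda> where "\<Lambda> = \<bar>\<mu>\<bar> * b + b\<^sup>2 + \<bar>\<mu>\<bar> + 1"
  \<comment> \<open>\<open>z\<close> is a strict supersolution: a large \<open>b\<close> gives the strict Robin inequality at \<open>0\<close>,
    then a large \<open>\<Lambda>\<close> gives the strict differential inequality.\<close>
  define z where "z t x = exp (\<Lambda> * t) * (exp (- (b * x)) + exp x)" for t x
  define zx where "zx t x = exp (\<Lambda> * t) * (- b * exp (- (b * x)) + exp x)" for t x
  define zxx where "zxx t x = exp (\<Lambda> * t) * (b\<^sup>2 * exp (- (b * x)) + exp x)" for t x
  have b: "2 \<le> b" unfolding b_def by simp
  have \<Lambda>: "0 \<le> \<Lambda>" unfolding \<Lambda>_def using b by (simp add: add_nonneg_nonneg)
  have z_pos: "0 < z t x" for t x unfolding z_def by (simp add: add_pos_pos)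
  have z_ge: "exp x \<le> z t x" if "0 \<le> t" for t x
  proof -
    have "1 * exp x \<le> exp (\<Lambda> * t) * (exp (- (b * x)) + exp x)"
      using that \<Lambda> by (intro mult_mono) auto
    then show ?thesis unfolding z_def by simp
  qed
  have zx_deriv: "((\<lambda>y. z t y) has_real_derivative zx t x) (at x within A)" for t x A
    unfolding z_def zx_def by (auto intro!: derivative_eq_intros simp: algebra_simps)
  have zxx_deriv: "((\<lambda>y. zx t y) has_real_derivative zxx t x) (at x)" for t x
    unfolding zx_def zxx_def by (auto intro!: derivative_eq_intros simp: algebra_simps power2_eq_square)
  have zt_deriv: "((\<lambda>s. z s x) has_real_derivative \<Lambda> * z t x) (at t)" for t x
    unfolding z_def by (auto intro!: derivative_eq_intros simp: algebra_simps)
  have super: "\<mu> * zx t x + zxx t x / 2 < \<Lambda> * z t x" for t x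
  proof -
    have "- (\<mu> * b) \<le> \<bar>\<mu>\<bar> * b" using b abs_mult[of \<mu> b] by linarith
    moreover have "0 \<le> b\<^sup>2" "0 \<le> \<bar>\<mu>\<bar> * b" using b by auto
    ultimately have "- (\<mu> * b) + b\<^sup>2 / 2 < \<Lambda>" "\<mu> + 1 / 2 < \<Lambda>" unfolding \<Lambda>_def by linarith+
    then have "(- (\<mu> * b) + b\<^sup>2 / 2) * exp (- (b * x)) + (\<mu> + 1 / 2) * exp x
        < \<Lambda> * exp (- (b * x)) + \<Lambda> * exp x"
      by (intro add_strict_mono mult_strict_right_mono) auto
    then have "exp (\<Lambda> * t) * ((- (\<mu> * b) + b\<^sup>2 / 2) * exp (- (b * x)) + (\<mu> + 1 / 2) * exp x)
        < exp (\<Lambda> * t) * (\<Lambda> * exp (- (b * x)) + \<Lambda> * exp x)"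
      by (intro mult_strict_left_mono) auto
    then show ?thesis unfolding z_def zx_def zxx_def by (simp add: algebra_simps add_divide_distrib)
  qed
  have robin_z: "zx t 0 < \<gamma> * z t 0" for t
  proof -
    have "1 - b < \<gamma> * 2" unfolding b_def by linarith
    then have "exp (\<Lambda> * t) * (1 - b) < exp (\<Lambda> * t) * (\<gamma> * 2)" by (intro mult_strict_left_mono) auto
    then show ?thesis unfolding z_def zx_def by (simp add: algebra_simps)
  qed
  define q1 where "q1 = w t1 x1 / z t1 x1"
  have q1: "0 < q1" unfolding q1_def using pos z_pos by simp
  \<comment> \<open>Beyond \<open>M / q1\<close> the growth of \<open>z\<close> forces
    \<open>w \<le> M \<le> q1 * z\<close>, so the maximum over the compact box dominates the
    quotient on the whole strip.\<close>
  define R where "R = max x1 (M / q1)"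
  have "compact ({0..T} \<times> {0..R})" by (intro compact_Times compact_Icc)
  moreover have mem1: "(t1, x1) \<in> {0..T} \<times> {0..R}" using t1 x1 unfolding R_def by auto
  moreover have "continuous_on ({0..T} \<times> {0..R}) (\<lambda>(t, x). w t x / z t x)"
  proof -
    have "continuous_on ({0..T} \<times> {0..R}) (\<lambda>p. w (fst p) (snd p))"
    proof -
      have "{0..T} \<times> {0..R} \<subseteq> {0..T} \<times> {0..}" by auto
      from continuous_on_subset[OF cont this] show ?thesis by (simp add: case_prod_beta)
    qed
    moreover have "continuous_on ({0..T} \<times> {0..R}) (\<lambda>p. z (fst p) (snd p))"
      unfolding z_def by (intro continuous_intros)
    ultimately show ?thesis
      unfolding case_prod_beta using z_pos by (intro continuous_on_divide) (auto simp: less_imp_neq[symmetric])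
  qed
  ultimately obtain p0 where p0: "p0 \<in> {0..T} \<times> {0..R}"
    "\<And>p. p \<in> {0..T} \<times> {0..R} \<Longrightarrow> (case p of (t, x) \<Rightarrow> w t x / z t x) \<le> (case p0 of (t, x) \<Rightarrow> w t x / z t x)"
    using continuous_attains_sup[of "{0..T} \<times> {0..R}" "\<lambda>(t, x). w t x / z t x"] by blast
  obtain t0 x0 where tx0: "p0 = (t0, x0)" by force
  define m where "m = w t0 x0 / z t0 x0"
  have t0: "0 \<le> t0" "t0 \<le> T" and x0: "0 \<le> x0" using p0(1) tx0 by auto
  have "q1 \<le> m" using p0(2)[OF mem1] tx0 unfolding q1_def m_def by simp
  then have m: "0 < m" using q1 by simp
  have eq: "w t0 x0 = m * z t0 x0" unfolding m_def using z_pos[of t0 x0] by simp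
  have le: "w t x \<le> m * z t x" if t: "0 \<le> t" "t \<le> T" and x: "0 \<le> x" for t x
  proof (cases "x \<le> R")
    case True
    then have "w t x / z t x \<le> m" using p0(2)[of "(t, x)"] t x tx0 unfolding m_def by auto
    then show ?thesis using z_pos[of t x] by (simp add: divide_le_eq)
  next
    case False
    have "M / q1 \<le> exp x" using False exp_ge_add_one_self[of x] unfolding R_def by linarith
    then have "M \<le> q1 * exp x" using q1 by (simp add: divide_le_eq mult.commute)
    also have "\<dots> \<le> m * z t x" using \<open>q1 \<le> m\<close> q1 z_ge[OF t(1)] by (intro mult_mono) auto
    finally show ?thesis using bound[OF t x] by linarith
  qed
  have "0 < t0"
  proof (rule ccontr)
    assume "\<not> 0 < t0"
    then have "w t0 x0 \<le> 0" using init x0 t0 by simp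
    moreover have "0 < m * z t0 x0" using m z_pos by simp
    ultimately show False using eq by simp
  qed
  show False
  proof (cases "x0 = 0")
    case True
    have D: "((\<lambda>y. w t0 y - m * z t0 y) has_real_derivative wx t0 0 - m * zx t0 0) (at 0 within {0..})"
      by (intro DERIV_diff DERIV_cmult zx_deriv wx \<open>0 < t0\<close>) simp
    \<comment> \<open>At the boundary \<open>w - m * z\<close> is maximal among points to its right,
      so its one-sided derivative cannot be positive.\<close>
    have "\<not> 0 < wx t0 0 - m * zx t0 0"
    proof
      assume "0 < wx t0 0 - m * zx t0 0"
      from has_real_derivative_pos_inc_right[OF D this] obtain d where
        d: "d > 0" "\<And>h. h > 0 \<Longrightarrow> h < d \<Longrightarrow> w t0 0 - m * z t0 0 < w t0 h - m * z t0 h" by auto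
      from d(2)[of "d / 2"] le[OF t0, of "d / 2"] eq True d(1) show False by simp
    qed
    then have "wx t0 0 \<le> m * zx t0 0" by simp
    also have "\<dots> < m * (\<gamma> * z t0 0)" using m robin_z by (intro mult_strict_left_mono)
    also have "\<dots> = \<gamma> * w t0 0" using eq True by simp
    finally show False using robin[OF \<open>0 < t0\<close>] by simp
  next
    case False
    then have "0 < x0" using x0 by simp
    have dx: "((\<lambda>y. w t0 y - m * z t0 y) has_real_derivative wx t0 x - m * zx t0 x) (at x)" if "0 < x" for x
    proof -
      have "((\<lambda>y. w t0 y) has_real_derivative wx t0 x) (at x within {0<..})"
        by (rule DERIV_subset[OF wx[OF \<open>0 < t0\<close>]]) (use that in auto)
      then have "((\<lambda>y. w t0 y) has_real_derivative wx t0 x) (at x)"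
        using that by (simp add: at_within_open[of x "{0<..}"])
      then show ?thesis by (intro DERIV_diff DERIV_cmult zx_deriv)
    qed
    have dxx: "((\<lambda>y. wx t0 y - m * zx t0 y) has_real_derivative wxx t0 x0 - m * zxx t0 x0) (at x0)"
      by (intro DERIV_diff DERIV_cmult zxx_deriv wxx \<open>0 < t0\<close> \<open>0 < x0\<close>)
    have max: "w t0 x - m * z t0 x \<le> w t0 x0 - m * z t0 x0" if "0 < x" for x
      using le[OF t0, of x] eq that by simp
    note xx = second_derivative_nonpos_at_max[OF dx dxx \<open>0 < x0\<close> max]
    have D: "((\<lambda>s. w s x0 - m * z s x0) has_real_derivative \<mu> * wx t0 x0 + wxx t0 x0 / 2 - m * (\<Lambda> * z t0 x0)) (at t0)"
      by (intro DERIV_diff DERIV_cmult zt_deriv wt \<open>0 < t0\<close> \<open>0 < x0\<close>)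
    \<comment> \<open>Only earlier times are compared, because \<open>t0\<close> may be the final
      time \<open>T\<close>; the time derivative there cannot be negative.\<close>
    have "\<not> \<mu> * wx t0 x0 + wxx t0 x0 / 2 - m * (\<Lambda> * z t0 x0) < 0"
    proof
      assume "\<mu> * wx t0 x0 + wxx t0 x0 / 2 - m * (\<Lambda> * z t0 x0) < 0"
      from DERIV_neg_dec_left[OF D this] obtain d where
        d: "d > 0" "\<And>h. h > 0 \<Longrightarrow> h < d \<Longrightarrow> w t0 x0 - m * z t0 x0 < w (t0 - h) x0 - m * z (t0 - h) x0" by blast
      define h where "h = min (d / 2) (t0 / 2)"
      have "0 < h" "h < d" "h < t0" using d(1) \<open>0 < t0\<close> unfolding h_def by auto
      with d(2)[of h] le[of "t0 - h" x0] eq x0 t0 show False by simp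
    qed
    then have "m * (\<Lambda> * z t0 x0) \<le> \<mu> * wx t0 x0 + wxx t0 x0 / 2" by simp
    also have "\<dots> \<le> \<mu> * (m * zx t0 x0) + (m * zxx t0 x0) / 2" using xx by simp
    also have "\<dots> = m * (\<mu> * zx t0 x0 + zxx t0 x0 / 2)" by (simp add: algebra_simps)
    also have "\<dots> < m * (\<Lambda> * z t0 x0)" using m super by (intro mult_strict_left_mono)
    finally show False by simp
  qed
qed

section \<open>The problem satisfied by the gradient\<close>

text \<open>Smoothness supplies the existence and continuity of all iterated derivatives of
  \<open>v\<close>. The equation for \<open>w\<close> also needs that the mixed derivatives agree,
  which is proved through integrals. Equating the two expressions for the time derivative at the
  boundary gives the Robin condition.\<close>

lemma solution_gradient:
  assumes "is_solution \<mu> \<nu> f v"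
  obtains w wx wxx where
    "\<And>t x. 0 \<le> t \<Longrightarrow> 0 \<le> x \<Longrightarrow> ((\<lambda>y. v t y) has_real_derivative w t x) (at x within {0..})"
    "\<And>T. 0 < T \<Longrightarrow> Cb2_on ({0..T} \<times> {0..}) w"
    "\<And>t x. 0 < t \<Longrightarrow> 0 \<le> x \<Longrightarrow> ((\<lambda>y. w t y) has_real_derivative wx t x) (at x within {0..})"
    "\<And>t x. 0 < t \<Longrightarrow> 0 < x \<Longrightarrow> ((\<lambda>y. wx t y) has_real_derivative wxx t x) (at x)"
    "\<And>t x. 0 < t \<Longrightarrow> 0 < x \<Longrightarrow> ((\<lambda>s. w s x) has_real_derivative \<mu> * wx t x + wxx t x / 2) (at t)"
    "\<And>t. 0 < t \<Longrightarrow> wx t 0 = 2 * (\<nu> - \<mu>) * w t 0"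
proof -
  let ?S = "{0::real<..} \<times> {0::real..}"
  have smooth: "smooth2_on ?S v" using assms by (simp add: is_solution_def)
  from assms obtain w where sol:
    "\<forall>t\<ge>0. \<forall>x\<ge>0. ((\<lambda>y. v t y) has_real_derivative w t x) (at x within {0..})"
    "\<forall>T>0. Cb2_on ({0..T} \<times> {0..}) v \<and> Cb2_on ({0..T} \<times> {0..}) w"
    "\<forall>t>0. \<forall>x\<ge>0. \<exists>uxx. ((\<lambda>y. w t y) has_real_derivative uxx) (at x within {0..})
                          \<and> ((\<lambda>s. v s x) has_real_derivative (\<mu> * w t x + uxx / 2)) (at t)"
    "\<forall>t>0. ((\<lambda>s. v s 0) has_real_derivative (\<nu> * w t 0)) (at t)"
    unfolding is_solution_def by (elim conjE exE)
  note w = sol(1)[rule_format]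
  have Cb: "\<And>T. 0 < T \<Longrightarrow> Cb2_on ({0..T} \<times> {0..}) w" using sol(2) by simp
  note pde = sol(3)[rule_format] and bc = sol(4)[rule_format]
  have slice_x: "{y. (t, y) \<in> ?S} = {0..}" if "0 < t" for t using that by auto
  have slice_t: "{s. (s, x) \<in> ?S} = {0<..}" if "0 \<le> x" for x using that by auto
  \<comment> \<open>This makes the gradient from the notion of solution an iterated derivative of
    \<open>v\<close>, so that smoothness applies to it.\<close>
  have w_pd: "is_pderiv ?S v w"
    by (rule is_pderiv.dx[OF is_pderiv.base], intro allI impI, subst slice_x) (auto intro: w)
  have ex_dx: "\<exists>h. \<forall>t x. (t, x) \<in> ?S \<longrightarrow> ((\<lambda>y. g t y) has_real_derivative h t x) (at x within {y. (t, y) \<in> ?S})"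
    if "is_pderiv ?S v g" for g using smooth that unfolding smooth2_on_def by blast
  have ex_dt: "\<exists>h. \<forall>t x. (t, x) \<in> ?S \<longrightarrow> ((\<lambda>s. g s x) has_real_derivative h t x) (at t within {s. (s, x) \<in> ?S})"
    if "is_pderiv ?S v g" for g using smooth that unfolding smooth2_on_def by blast
  obtain wx where wx0: "\<forall>t x. (t, x) \<in> ?S \<longrightarrow> ((\<lambda>y. w t y) has_real_derivative wx t x) (at x within {y. (t, y) \<in> ?S})"
    using ex_dx[OF w_pd] by blast
  have wx_pd: "is_pderiv ?S v wx" by (rule is_pderiv.dx[OF w_pd wx0])
  have wx: "((\<lambda>y. w t y) has_real_derivative wx t x) (at x within {0..})" if "0 < t" "0 \<le> x" for t x
    using wx0[rule_format, of t x] that slice_x[of t] by simp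
  obtain wxx where wxx0: "\<forall>t x. (t, x) \<in> ?S \<longrightarrow> ((\<lambda>y. wx t y) has_real_derivative wxx t x) (at x within {y. (t, y) \<in> ?S})"
    using ex_dx[OF wx_pd] by blast
  have at: "(g has_real_derivative d) (at x)" if "(g has_real_derivative d) (at x within {0..})" "0 < x" for g d and x :: real
  proof -
    have "(g has_real_derivative d) (at x within {0<..})"
      by (rule DERIV_subset[OF that(1)]) auto
    then show ?thesis using that(2) by (simp add: at_within_open[of x "{0<..}"])
  qed
  have wxx: "((\<lambda>y. wx t y) has_real_derivative wxx t x) (at x)" if "0 < t" "0 < x" for t x
    using wxx0[rule_format, of t x] that slice_x[of t] by (intro at) simp_all
  obtain wt where wt0: "\<forall>t x. (t, x) \<in> ?S \<longrightarrow> ((\<lambda>s. w s x) has_real_derivative wt t x) (at t within {s. (s, x) \<in> ?S})"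
    using ex_dt[OF w_pd] by blast
  have wt: "((\<lambda>s. w s x) has_real_derivative wt t x) (at t within {0<..})" if "0 < t" "0 \<le> x" for t x
    using wt0[rule_format, of t x] that slice_t[of x] by simp
  have "is_pderiv ?S v wt" by (rule is_pderiv.dt[OF w_pd wt0])
  then have wt_cont: "continuous_on ?S (\<lambda>(t, x). wt t x)" using smooth unfolding smooth2_on_def by blast
  define vt where "vt t x = \<mu> * w t x + wx t x / 2" for t x
  have vt: "((\<lambda>s. v s x) has_real_derivative vt t x) (at t)" if t: "0 < t" and x: "0 \<le> x" for t x
  proof -
    from pde[OF that] obtain d where d: "((\<lambda>y. w t y) has_real_derivative d) (at x within {0..})"
      "((\<lambda>s. v s x) has_real_derivative (\<mu> * w t x + d / 2)) (at t)" by blast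
    have "d = wx t x"
      by (rule has_field_derivative_unique[OF d(1) wx[OF that] at_within_half_line_neq_bot[OF x]])
    with d(2) show ?thesis unfolding vt_def by simp
  qed
  have robin: "wx t 0 = 2 * (\<nu> - \<mu>) * w t 0" if "0 < t" for t
    using DERIV_unique[OF vt[OF that order_refl] bc[OF that]] unfolding vt_def by (simp add: algebra_simps)
  have int_w: "(w t has_integral v t x - v t 0) {0..x}" if "0 < t" "0 \<le> x" for t x
  proof (rule fundamental_theorem_of_calculus[OF that(2)])
    fix y assume "y \<in> {0..x}"
    then show "((\<lambda>y. v t y) has_vector_derivative w t y) (at y within {0..x})"
      unfolding has_real_derivative_iff_has_vector_derivative[symmetric]
      by (intro DERIV_subset[OF w]) (use that in auto)
  qed
  \<comment> \<open>Equality of the mixed derivatives of \<open>v\<close>, by differentiating \<open>int_w\<close> in time.\<close>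
  have int_wt: "integral {0..x} (wt t) = vt t x - vt t 0" if t: "0 < t" and x: "0 \<le> x" for t x
  proof -
    have "((\<lambda>s. integral (cbox 0 x) (w s)) has_real_derivative integral (cbox 0 x) (wt t)) (at t within {0<..})"
    proof (rule leibniz_rule_field_derivative)
      show "((\<lambda>s. w s y) has_real_derivative wt s y) (at s within {0<..})"
        if "s \<in> {0<..}" "y \<in> cbox 0 x" for s y using wt that by simp
      show "w s integrable_on cbox 0 x" if "s \<in> {0<..}" for s
        using int_w[of s x] that x by (auto simp: integrable_on_def)
      show "continuous_on ({0<..} \<times> cbox 0 x) (\<lambda>(s, y). wt s y)"
        by (rule continuous_on_subset[OF wt_cont]) auto
    qed (use t in auto)
    then have "((\<lambda>s. integral {0..x} (w s)) has_real_derivative integral {0..x} (wt t)) (at t)"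
      using t by (simp add: at_within_open[of t "{0<..}"])
    moreover have "((\<lambda>s. integral {0..x} (w s)) has_real_derivative vt t x - vt t 0) (at t)"
    proof (rule has_field_derivative_transform_within[OF DERIV_diff[OF vt[OF t x] vt[OF t order_refl]]])
      show "v s x - v s 0 = integral {0..x} (w s)" if "dist s t < t" for s
        using int_w[of s x] that x by (intro integral_unique[symmetric]) (auto simp: dist_real_def)
    qed (use t in auto)
    ultimately show ?thesis by (rule DERIV_unique)
  qed
  \<comment> \<open>The time derivative of \<open>v\<close> is differentiated in \<open>x\<close>
    twice over: from its formula in \<open>w\<close> and \<open>wx\<close>, and from
    \<open>int_wt\<close> by the fundamental theorem of calculus.\<close>
  have wt_eq: "wt t x = \<mu> * wx t x + wxx t x / 2" if t: "0 < t" and x: "0 < x" for t x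
  proof (rule DERIV_unique)
    show "((\<lambda>y. vt t y) has_real_derivative \<mu> * wx t x + wxx t x / 2) (at x)"
      unfolding vt_def using t x by (intro DERIV_add DERIV_cmult DERIV_cdivide at[OF wx] wxx) auto
    \<comment> \<open>The interval reaches to \<open>x + 1\<close> so that \<open>x\<close> is
      interior and the derivative is two-sided.\<close>
    have "continuous_on {0..x + 1} (\<lambda>y. wt t y)"
      using t by (intro continuous_on_compose2[OF wt_cont, where f="\<lambda>y. (t, y)", simplified]) (auto intro!: continuous_intros)
    from integral_has_vector_derivative[OF this, of x]
    have "((\<lambda>y. integral {0..y} (wt t)) has_real_derivative wt t x) (at x within {0..x + 1})"
      using x by (simp add: has_real_derivative_iff_has_vector_derivative)
    then have "((\<lambda>y. integral {0..y} (wt t)) has_real_derivative wt t x) (at x)"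
      using x by (simp add: at_within_Icc_at)
    then have "((\<lambda>y. integral {0..y} (wt t) + vt t 0) has_real_derivative wt t x) (at x)"
      by (auto intro!: derivative_eq_intros)
    then show "((\<lambda>y. vt t y) has_real_derivative wt t x) (at x)"
    proof (rule has_field_derivative_transform_within)
      show "integral {0..y} (wt t) + vt t 0 = vt t y" if "dist y x < x" for y
        using int_wt[OF t, of y] that by (auto simp: dist_real_def)
    qed (use x in auto)
  qed
  show thesis
  proof (rule that[OF w Cb wx wxx _ robin])
    show "((\<lambda>s. w s x) has_real_derivative \<mu> * wx t x + wxx t x / 2) (at t)" if "0 < t" "0 < x" for t x
      using wt[of t x] wt_eq[OF that] that by (simp add: at_within_open[of t "{0<..}"])
  qed
qed

section \<open>Comparison of two solutions\<close>

text \<open>The difference of the gradients solves the homogeneous Robin problem with zero initial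
  values, so the maximum principle applies. The statement is one-sided; exchanging the solutions
  gives equality. It speaks of arbitrary derivatives \<open>d\<close> and \<open>e\<close> because
  the gradient is existentially bound in \<open>is_solution\<close>.\<close>

lemma solution_gradient_le:
  assumes u: "is_solution \<mu> \<nu> f u" and v: "is_solution \<mu> \<nu> f v"
    and du: "(u t has_real_derivative d) (at x within {0..})"
    and dv: "(v t has_real_derivative e) (at x within {0..})"
    and t: "0 \<le> t" and x: "0 \<le> x"
  shows "d \<le> e"
proof -
  note unique = has_field_derivative_unique[OF _ _ at_within_half_line_neq_bot]
  obtain p px pxx where p: 
    "\<And>t x. 0 \<le> t \<Longrightarrow> 0 \<le> x \<Longrightarrow> ((\<lambda>y. u t y) has_real_derivative p t x) (at x within {0..})"
    "\<And>T. 0 < T \<Longrightarrow> Cb2_on ({0..T} \<times> {0..}) p"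
    "\<And>t x. 0 < t \<Longrightarrow> 0 \<le> x \<Longrightarrow> ((\<lambda>y. p t y) has_real_derivative px t x) (at x within {0..})"
    "\<And>t x. 0 < t \<Longrightarrow> 0 < x \<Longrightarrow> ((\<lambda>y. px t y) has_real_derivative pxx t x) (at x)"
    "\<And>t x. 0 < t \<Longrightarrow> 0 < x \<Longrightarrow> ((\<lambda>s. p s x) has_real_derivative \<mu> * px t x + pxx t x / 2) (at t)"
    "\<And>t. 0 < t \<Longrightarrow> px t 0 = 2 * (\<nu> - \<mu>) * p t 0"
    by (rule solution_gradient[OF u]) blast
  obtain q qx qxx where q: 
    "\<And>t x. 0 \<le> t \<Longrightarrow> 0 \<le> x \<Longrightarrow> ((\<lambda>y. v t y) has_real_derivative q t x) (at x within {0..})"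
    "\<And>T. 0 < T \<Longrightarrow> Cb2_on ({0..T} \<times> {0..}) q"
    "\<And>t x. 0 < t \<Longrightarrow> 0 \<le> x \<Longrightarrow> ((\<lambda>y. q t y) has_real_derivative qx t x) (at x within {0..})"
    "\<And>t x. 0 < t \<Longrightarrow> 0 < x \<Longrightarrow> ((\<lambda>y. qx t y) has_real_derivative qxx t x) (at x)"
    "\<And>t x. 0 < t \<Longrightarrow> 0 < x \<Longrightarrow> ((\<lambda>s. q s x) has_real_derivative \<mu> * qx t x + qxx t x / 2) (at t)"
    "\<And>t. 0 < t \<Longrightarrow> qx t 0 = 2 * (\<nu> - \<mu>) * q t 0"
    by (rule solution_gradient[OF v]) blast
  \<comment> \<open>Adding 1 keeps the horizon positive also when \<open>t = 0\<close>.\<close>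
  define T where "T = t + 1"
  have T: "0 < T" using t unfolding T_def by simp
  \<comment> \<open>At time 0 both solutions equal \<open>f\<close> on the half line, so their
    one-sided derivatives agree.\<close>
  have init: "p 0 x = q 0 x" if "0 \<le> x" for x
  proof (rule unique)
    show "((\<lambda>y. u 0 y) has_real_derivative p 0 x) (at x within {0..})" using p(1) that by simp
    show "((\<lambda>y. u 0 y) has_real_derivative q 0 x) (at x within {0..})"
      by (rule has_field_derivative_transform_within[OF q(1)[OF order_refl that], of 1])
         (use u v that in \<open>auto simp: is_solution_def\<close>)
  qed fact
  obtain M N where MN: "\<And>t x. 0 \<le> t \<Longrightarrow> t \<le> T \<Longrightarrow> 0 \<le> x \<Longrightarrow> \<bar>p t x\<bar> \<le> M"
    "\<And>t x. 0 \<le> t \<Longrightarrow> t \<le> T \<Longrightarrow> 0 \<le> x \<Longrightarrow> \<bar>q t x\<bar> \<le> N"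
  proof -
    have "\<exists>M. \<forall>t x. 0 \<le> t \<longrightarrow> t \<le> T \<longrightarrow> 0 \<le> x \<longrightarrow> \<bar>g t x\<bar> \<le> M"
      if "Cb2_on ({0..T} \<times> {0..}) g" for g
    proof -
      obtain M where "\<forall>p\<in>(\<lambda>(t, x). g t x) ` ({0..T} \<times> {0..}). norm p \<le> M"
        using \<open>Cb2_on ({0..T} \<times> {0..}) g\<close> unfolding Cb2_on_def bounded_iff by blast
      then show ?thesis by (intro exI[of _ M]) auto
    qed
    from this[OF p(2)[OF T]] this[OF q(2)[OF T]] show thesis using that by blast
  qed
  have "p t x - q t x \<le> 0"
  proof (rule robin_max_principle[where w="\<lambda>t x. p t x - q t x" and wx="\<lambda>t x. px t x - qx t x"
      and wxx="\<lambda>t x. pxx t x - qxx t x" and T=T and M="M + N" and \<gamma>="2 * (\<nu> - \<mu>)"])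
    show "continuous_on ({0..T} \<times> {0..}) (\<lambda>(t, x). p t x - q t x)"
      using continuous_on_diff[of _ "\<lambda>(t, x). p t x" "\<lambda>(t, x). q t x"] p(2)[OF T] q(2)[OF T]
      unfolding Cb2_on_def by (simp add: case_prod_beta)
    show "p t x - q t x \<le> M + N" if "0 \<le> t" "t \<le> T" "0 \<le> x" for t x
      using MN(1)[OF that] MN(2)[OF that] by linarith
    show "((\<lambda>s. p s x - q s x) has_real_derivative \<mu> * (px t x - qx t x) + (pxx t x - qxx t x) / 2) (at t)"
      if "0 < t" "0 < x" for t x
      using DERIV_diff[OF p(5)[OF that] q(5)[OF that]] by (simp add: algebra_simps diff_divide_distrib)
    show "px t 0 - qx t 0 = 2 * (\<nu> - \<mu>) * (p t 0 - q t 0)" if "0 < t" for t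
      unfolding p(6)[OF that] q(6)[OF that] by (simp add: algebra_simps)
    show "((\<lambda>y. p t y - q t y) has_real_derivative px t x - qx t x) (at x within {0..})"
      if "0 < t" "0 \<le> x" for t x by (rule DERIV_diff[OF p(3)[OF that] q(3)[OF that]])
    show "((\<lambda>y. px t y - qx t y) has_real_derivative pxx t x - qxx t x) (at x)"
      if "0 < t" "0 < x" for t x by (rule DERIV_diff[OF p(4)[OF that] q(4)[OF that]])
    show "p 0 x - q 0 x \<le> 0" if "0 \<le> x" for x using init[OF that] by simp
    show "t \<le> T" unfolding T_def by simp
  qed fact+
  moreover have "d = p t x" "e = q t x"
    using unique[OF du p(1)[OF t x] x] unique[OF dv q(1)[OF t x] x] by auto
  ultimately show ?thesis by simp
qed

lemma solution_unique:
  assumes u: "is_solution \<mu> \<nu> f u" and v: "is_solution \<mu> \<nu> f v"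
    and t: "0 \<le> t" and x: "0 \<le> x"
  shows "v t x = u t x"
\<comment> \<open>Decay at infinity is part of \<open>is_solution\<close> for positive times only;
  at time 0 both solutions equal \<open>f\<close>.\<close>
proof (cases "t = 0")
  case True
  then show ?thesis using u v x unfolding is_solution_def by simp
next
  case False
  obtain ux where ux: "\<And>x. 0 \<le> x \<Longrightarrow> (u t has_real_derivative ux t x) (at x within {0..})"
    by (rule solution_gradient[OF u]) (use t in blast)
  obtain vx where vx: "\<And>x. 0 \<le> x \<Longrightarrow> (v t has_real_derivative vx t x) (at x within {0..})"
    by (rule solution_gradient[OF v]) (use t in blast)
  have "((\<lambda>y. v t y - u t y) has_real_derivative 0) (at y within {0..})" if "y \<in> {0..}" for y
  proof -
    have "vx t y = ux t y"
      using that by (intro antisym solution_gradient_le[OF v u vx ux t] solution_gradient_le[OF u v ux vx t]) auto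
    then show ?thesis using DERIV_diff[OF vx ux, of y] that by simp
  qed
  then obtain c where c: "\<And>y. 0 \<le> y \<Longrightarrow> v t y - u t y = c"
    using has_field_derivative_zero_constant[of "{0..}" "\<lambda>y. v t y - u t y"] by auto
  have "((\<lambda>y. v t y - u t y) \<longlongrightarrow> 0 - 0) at_top"
    using u v t False unfolding is_solution_def by (intro tendsto_diff) auto
  moreover have "((\<lambda>y. v t y - u t y) \<longlongrightarrow> c) at_top"
    by (rule tendsto_eventually) (use eventually_ge_at_top[of 0] in eventually_elim, rule c)
  ultimately have "c = 0" using tendsto_unique[of at_top] by force
  with c[OF x] show ?thesis by simp
qed

text \<open>Uniqueness means agreement for \<open>t \<ge> 0\<close> and \<open>x \<ge> 0\<close>,
  because solutions are encoded as total functions whose values elsewhere are unconstrained.\<close>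

theorem theorem1:
  fixes \<mu> \<nu> :: real and f :: "real \<Rightarrow> real"
  assumes "Cb1_halfline f"
    and "(f \<longlongrightarrow> 0) at_top"
  shows "\<exists>u. is_solution \<mu> \<nu> f u \<and>
           (\<forall>v. is_solution \<mu> \<nu> f v \<longrightarrow> (\<forall>t\<ge>0. \<forall>x\<ge>0. v t x = u t x))"
  using solution_exists[OF assms] solution_unique by blast

end
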